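(* Let $N\ge 1$ be an integer, $p>1$ and $q>\frac{2p}{p+1}$. Let $x_0\in\mathbb{R}^N$, $R,T>0$, $M>0$, $\tau\ge 0$, and let $u$ be a nonnegative solution of $$u_t-\Delta u=u^p+M|\nabla u|^q\quad\text{in } Q_{T,R}$$ such that $u_t\le\tau$ in $Q_{T,R}$. (i) Then $$|\nabla u(x,t)|\le C(N,p,q)\left(M^{-\frac{p+1}{(p+1)q-2p}}+M^{-\frac1q}\tau^{\frac1q}\right)+C(N,M,p,q)\left(R^{-\frac{1}{q-1}}+t^{-\frac{1}{2(q-1)}}\right)\quad\text{in } Q_{T,R/2},$$ where $C(N,p,q)>0$ depends only on $N,p,q$ and $C(N,M,p,q)>0$ depends only on $N,M,p,q$. (ii) There exists a constant $c_{N,p,q}>0$, depending only on $N,p,q$, and a constant $C=C(N,M,p,q)>0$, depending only on $N,M,p,q$, such that if $$u\ge c_{N,p,q}\left(M^{-\frac{2}{(p+1)q-2p}}+\tau^{\frac1p}\right)\quad\text{in } Q_{T,R},$$ then $$|\nabla u(x,t)|\le C\left(R^{-\frac{1}{q-1}}+t^{-\frac{1}{2(q-1)}}\right)\quad\text{in } Q_{T,R/2}.$$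
   Context: For $x_0\in\mathbb{R}^N$ and $R,T>0$, $Q_{T,R}=B(x_0,R)\times(0,T)$, where $B(x_0,R)$ is the open ball of $\mathbb{R}^N$; $Q_{T,R/2}$ has the same center $x_0$. The operators $\nabla$ and $\Delta$ act only on the spatial variable $x$. A solution is a classical solution, i.e. it belongs to $C^{2,1}(Q_{T,R})$ ($C^2$ in $x$, $C^1$ in $t$). *)

theory Defs
  imports "HOL-Analysis.Analysis"
begin

definition gradient :: "(real ^ 'n \<Rightarrow> real) \<Rightarrow> real ^ 'n \<Rightarrow> real ^ 'n" where
  "gradient f x = (\<chi> i. frechet_derivative f (at x) (axis i 1))"

text \<open>The entry at row i and column j is the j-th partial derivative of the i-th partial derivative.\<close>
definition hessian :: "(real ^ 'n \<Rightarrow> real) \<Rightarrow> real ^ 'n \<Rightarrow> real ^ 'n ^ 'n" where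
  "hessian f x = (\<chi> i. gradient (\<lambda>y. gradient f y $ i) x)"

definition laplacian :: "(real ^ 'n \<Rightarrow> real) \<Rightarrow> real ^ 'n \<Rightarrow> real" where
  "laplacian f x = (\<Sum>i\<in>UNIV. hessian f x $ i $ i)"

definition cylinder :: "real ^ 'n \<Rightarrow> real \<Rightarrow> real \<Rightarrow> ((real ^ 'n) \<times> real) set" where
  "cylinder x0 R T = ball x0 R \<times> {0<..<T}"

text \<open>Space-time functions are curried and total. On an open set Q the predicate below depends only on
  the values on Q, since all derivatives are taken at interior points of its slices.
  Continuity is joint in space and time.\<close>
definition C21_on :: "((real ^ 'n) \<times> real) set \<Rightarrow> (real ^ 'n \<Rightarrow> real \<Rightarrow> real) \<Rightarrow> bool" where
  "C21_on Q u \<longleftrightarrow>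
     (\<forall>(x, t)\<in>Q.
        (\<lambda>y. u y t) differentiable (at x) \<and>
        gradient (\<lambda>y. u y t) differentiable (at x) \<and>
        u x differentiable (at t)) \<and>
     continuous_on Q (\<lambda>(x, t). u x t) \<and>
     continuous_on Q (\<lambda>(x, t). gradient (\<lambda>y. u y t) x) \<and>
     continuous_on Q (\<lambda>(x, t). hessian (\<lambda>y. u y t) x) \<and>
     continuous_on Q (\<lambda>(x, t). deriv (u x) t)"

text \<open>Nonnegativity is part of the predicate: it makes the real power of u meaningful.\<close>
definition nonneg_classical_solution ::
    "real \<Rightarrow> real \<Rightarrow> real \<Rightarrow> ((real ^ 'n) \<times> real) set \<Rightarrow> (real ^ 'n \<Rightarrow> real \<Rightarrow> real) \<Rightarrow> bool" where
  "nonneg_classical_solution p q M Q u \<longleftrightarrow>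
     C21_on Q u \<and>
     (\<forall>(x, t)\<in>Q.
        0 \<le> u x t \<and>
        deriv (u x) t - laplacian (\<lambda>y. u y t) x =
          u x t powr p + M * norm (gradient (\<lambda>y. u y t) x) powr q)"

end

theory Submission
  imports Defs
begin

text \<open>Bernstein's method applied to \<open>w = |\<nabla>u|\<^sup>2\<close>. Since \<open>u\<close> is only of class \<open>C\<^sup>2\<^sup>,\<^sup>1\<close>, the differential
  inequality for \<open>w\<close> is obtained in the viscosity sense: the sum of the squared difference quotients
  of \<open>u\<close> is itself \<open>C\<^sup>2\<^sup>,\<^sup>1\<close>, its heat operator involves only difference quotients of \<open>u\<close>, \<open>\<nabla>u\<close> and of
  the right-hand side \<open>f\<close>, and these converge locally uniformly. Hence
  \<open>w\<^sub>t - \<Delta>w \<le> - 2 |D\<^sup>2u|\<^sup>2 + 2 \<nabla>u \<cdot> \<nabla>f\<close> at every point where a test function touches \<open>w\<close> from above.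

  The Cauchy--Schwarz inequality and \<open>u\<^sub>t \<le> \<tau>\<close> give \<open>N |D\<^sup>2u|\<^sup>2 \<ge> (\<Delta>u)\<^sup>2 \<ge> (u\<^sup>p + M |\<nabla>u|\<^sup>q)\<^sup>2 / 4\<close>
  as soon as \<open>u\<^sup>p + M |\<nabla>u|\<^sup>q \<ge> 2 \<tau>\<close>. Because \<open>q > 2p / (p + 1)\<close>, this absorbs the bad term
  \<open>2 p u\<^sup>p\<^sup>-\<^sup>1 w\<close> when the gradient (case i) or the solution itself (case ii) is large. What remains is
  superlinear absorption \<open>- c M\<^sup>2 w\<^sup>q\<close>, and the estimate follows at a maximum point of \<open>\<phi> w\<close> for a
  suitable cutoff \<open>\<phi>\<close>, with \<open>max (\<phi> w) / \<phi>\<close> as test function.\<close>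

section \<open>Directional derivatives\<close>

text \<open>Derivatives are taken along single lines, so that one notion serves space and time. A
  function of class C^{2,1} is not twice differentiable in all variables jointly, but it has every
  line derivative used here.\<close>

definition has_dir_deriv :: "('a::real_normed_vector \<Rightarrow> real) \<Rightarrow> 'a \<Rightarrow> real \<Rightarrow> 'a \<Rightarrow> bool" where
  "has_dir_deriv f e d z \<longleftrightarrow> ((\<lambda>s. f (z + s *\<^sub>R e)) has_real_derivative d) (at 0)"

lemma has_dir_deriv_line:
  assumes "has_dir_deriv f e d (z + s *\<^sub>R e)"
  shows "((\<lambda>r. f (z + r *\<^sub>R e)) has_real_derivative d) (at s)"
proof -
  have "((\<lambda>r. f (z + r *\<^sub>R e)) has_real_derivative d) (at (0 + s))"
    unfolding DERIV_shift using assms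
    by (simp add: has_dir_deriv_def scaleR_add_left add_ac)
  then show ?thesis by simp
qed

text \<open>By the mean value theorem the quotient is \<open>f'\<close> at a point between
  \<open>Z n\<close> and \<open>Z n + h n *\<^sub>R e\<close>, and these points tend to
  \<open>z0\<close>. Since the base point moves together with the step, continuity of
  \<open>f'\<close> on the open set takes over the role of differentiability at
  \<open>z0\<close>.\<close>

lemma dir_quotient_tendsto:
  fixes f :: "'a::real_normed_vector \<Rightarrow> real"
  assumes Q: "open Q" "z0 \<in> Q"
    and der: "\<And>z. z \<in> Q \<Longrightarrow> has_dir_deriv f e (f' z) z"
    and cont: "continuous_on Q f'"
    and Z: "Z \<longlonglongrightarrow> z0" and h: "h \<longlonglongrightarrow> 0" "\<And>n. h n > (0::real)"
  shows "(\<lambda>n. (f (Z n + h n *\<^sub>R e) - f (Z n)) / h n) \<longlonglongrightarrow> f' z0"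
proof (rule tendstoI)
  fix \<epsilon> :: real assume "\<epsilon> > 0"
  have "isCont f' z0"
    using cont Q continuous_on_eq_continuous_at by blast
  then have "\<forall>\<^sub>F z in at z0. dist (f' z) (f' z0) < \<epsilon>"
    using \<open>\<epsilon> > 0\<close> by (simp add: isCont_def tendstoD)
  then have "\<forall>\<^sub>F z in nhds z0. dist (f' z) (f' z0) < \<epsilon>"
    using \<open>\<epsilon> > 0\<close> by (simp add: eventually_nhds_conv_at)
  moreover have "\<forall>\<^sub>F z in nhds z0. z \<in> Q"
    using Q by (simp add: eventually_nhds_in_open)
  ultimately have "\<forall>\<^sub>F z in nhds z0. z \<in> Q \<and> dist (f' z) (f' z0) < \<epsilon>"
    by eventually_elim simp
  then obtain \<delta> where \<delta>: "\<delta> > 0" "\<And>z. dist z z0 < \<delta> \<Longrightarrow> z \<in> Q \<and> dist (f' z) (f' z0) < \<epsilon>"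
    unfolding eventually_nhds_metric by blast
  have "(\<lambda>n. h n *\<^sub>R e) \<longlonglongrightarrow> 0"
    using tendsto_scaleR[OF h(1) tendsto_const, of e] by simp
  then have "\<forall>\<^sub>F n in sequentially. dist (h n *\<^sub>R e) 0 < \<delta>/2"
    by (rule tendstoD) (use \<delta>(1) in simp)
  moreover have "\<forall>\<^sub>F n in sequentially. dist (Z n) z0 < \<delta>/2"
    using Z by (rule tendstoD) (use \<delta>(1) in simp)
  ultimately show "\<forall>\<^sub>F n in sequentially. dist ((f (Z n + h n *\<^sub>R e) - f (Z n)) / h n) (f' z0) < \<epsilon>"
  proof eventually_elim
    case (elim n)
    have near: "dist (Z n + s *\<^sub>R e) z0 < \<delta>" if "0 \<le> s" "s \<le> h n" for s
    proof -
      have "norm (s *\<^sub>R e) \<le> norm (h n *\<^sub>R e)"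
        using that by (simp add: mult_right_mono)
      then have "norm (s *\<^sub>R e) < \<delta>/2" using elim by simp
      moreover have "dist (Z n + s *\<^sub>R e) z0 \<le> norm (s *\<^sub>R e) + dist (Z n) z0"
        using norm_triangle_ineq[of "s *\<^sub>R e" "Z n - z0"] by (simp add: dist_norm algebra_simps)
      ultimately show ?thesis using elim by linarith
    qed
    have "\<exists>\<theta>. 0 < \<theta> \<and> \<theta> < h n \<and>
        f (Z n + h n *\<^sub>R e) - f (Z n + 0 *\<^sub>R e) = (h n - 0) * f' (Z n + \<theta> *\<^sub>R e)"
    proof (rule MVT2[OF h(2)])
      fix s assume "0 \<le> s" "s \<le> h n"
      then show "((\<lambda>r. f (Z n + r *\<^sub>R e)) has_real_derivative f' (Z n + s *\<^sub>R e)) (at s)"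
        using near \<delta>(2) der by (intro has_dir_deriv_line) blast
    qed
    then obtain \<theta> where \<theta>: "0 < \<theta>" "\<theta> < h n"
      "(f (Z n + h n *\<^sub>R e) - f (Z n)) / h n = f' (Z n + \<theta> *\<^sub>R e)"
      using h(2)[of n] by (auto simp: field_simps)
    then show ?case using \<delta>(2) near[of \<theta>] by simp
  qed
qed

text \<open>At the maximum \<open>f' 0\<close> vanishes. If \<open>d\<close> were positive,
  \<open>f'\<close> would be positive just to the right of 0, and the mean value theorem would lift
  \<open>f\<close> above \<open>f 0\<close>.\<close>

lemma second_deriv_nonpos_at_max:
  fixes f f' :: "real \<Rightarrow> real"
  assumes r: "r > 0"
    and der: "\<And>s. \<bar>s\<bar> < r \<Longrightarrow> (f has_real_derivative f' s) (at s)"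
    and der2: "(f' has_real_derivative d) (at 0)"
    and max: "\<And>s. \<bar>s\<bar> < r \<Longrightarrow> f s \<le> f 0"
  shows "d \<le> 0"
proof (rule ccontr)
  assume "\<not> d \<le> 0"
  then obtain \<delta> where \<delta>: "\<delta> > 0" "\<And>h. 0 < h \<Longrightarrow> h < \<delta> \<Longrightarrow> f' 0 < f' (0 + h)"
    using DERIV_pos_inc_right[OF der2] by auto
  have "f' 0 = 0"
    using r max by (intro DERIV_local_max[OF der[of 0] r]) auto
  define s where "s = min r \<delta> / 2"
  have s: "0 < s" "s < r" "s < \<delta>" using r \<delta>(1) by (auto simp: s_def)
  have "\<exists>\<theta>. 0 < \<theta> \<and> \<theta> < s \<and> f s - f 0 = (s - 0) * f' \<theta>"
    using s by (intro MVT2 der) auto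
  then obtain \<theta> where \<theta>: "0 < \<theta>" "\<theta> < s" "f s - f 0 = s * f' \<theta>" by auto
  have "f' \<theta> > 0" using \<delta>(2)[of \<theta>] \<theta> s \<open>f' 0 = 0\<close> by simp
  then have "f s > f 0" using \<theta>(3) s(1) mult_pos_pos[of s "f' \<theta>"] by linarith
  then show False using max[of s] s by simp
qed

text \<open>The one-sided version serves the time variable: the maximum is taken over the past and
  may be attained at the final time.\<close>

lemma deriv_nonneg_at_left_max:
  fixes f :: "real \<Rightarrow> real"
  assumes r: "r > 0" and der: "(f has_real_derivative d) (at 0)"
    and max: "\<And>s. -r < s \<Longrightarrow> s \<le> 0 \<Longrightarrow> f s \<le> f 0"
  shows "d \<ge> 0"
proof (rule ccontr)
  assume "\<not> d \<ge> 0"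
  then obtain \<delta> where \<delta>: "\<delta> > 0" "\<And>h. 0 < h \<Longrightarrow> h < \<delta> \<Longrightarrow> f 0 < f (0 - h)"
    using DERIV_neg_dec_left[OF der] by auto
  define s where "s = min r \<delta> / 2"
  have s: "0 < s" "s < r" "s < \<delta>" using r \<delta>(1) by (auto simp: s_def)
  show False using \<delta>(2)[of s] max[of "-s"] s by simp
qed

lemma has_dir_deriv_shift:
  assumes "has_dir_deriv f e d (z + v)"
  shows "has_dir_deriv (\<lambda>z. f (z + v)) e d z"
  using assms by (simp add: has_dir_deriv_def add_ac)

lemma has_dir_deriv_cong: "has_dir_deriv f e d z \<Longrightarrow> d = d' \<Longrightarrow> has_dir_deriv f e d' z"
  by simp

lemma has_dir_deriv_const [simp]: "has_dir_deriv (\<lambda>z. c) e 0 z"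
  by (simp add: has_dir_deriv_def)

lemma has_dir_deriv_diff:
  "has_dir_deriv f e d z \<Longrightarrow> has_dir_deriv g e d' z \<Longrightarrow> has_dir_deriv (\<lambda>z. f z - g z) e (d - d') z"
  by (auto simp: has_dir_deriv_def intro!: derivative_eq_intros)

lemma has_dir_deriv_add:
  "has_dir_deriv f e d z \<Longrightarrow> has_dir_deriv g e d' z \<Longrightarrow> has_dir_deriv (\<lambda>z. f z + g z) e (d + d') z"
  by (auto simp: has_dir_deriv_def intro!: derivative_eq_intros)

lemma has_dir_deriv_mult:
  "has_dir_deriv f e d z \<Longrightarrow> has_dir_deriv g e d' z \<Longrightarrow>
    has_dir_deriv (\<lambda>z. f z * g z) e (d * g z + d' * f z) z"
  unfolding has_dir_deriv_def using DERIV_mult by fastforce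

lemma has_dir_deriv_power:
  "has_dir_deriv f e d z \<Longrightarrow> has_dir_deriv (\<lambda>z. f z ^ n) e (of_nat n * (d * f z ^ (n - Suc 0))) z"
  unfolding has_dir_deriv_def using DERIV_power by fastforce

lemma has_dir_deriv_cmult:
  "has_dir_deriv f e d z \<Longrightarrow> has_dir_deriv (\<lambda>z. c * f z) e (c * d) z"
  unfolding has_dir_deriv_def by (rule DERIV_cmult)

lemma has_dir_deriv_divide_const:
  "has_dir_deriv f e d z \<Longrightarrow> has_dir_deriv (\<lambda>z. f z / c) e (d / c) z"
  unfolding has_dir_deriv_def by (rule DERIV_cdivide)

lemma has_dir_deriv_sum:
  "(\<And>i. i \<in> S \<Longrightarrow> has_dir_deriv (f i) e (d i) z) \<Longrightarrow> has_dir_deriv (\<lambda>z. \<Sum>i\<in>S. f i z) e (\<Sum>i\<in>S. d i) z"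
  unfolding has_dir_deriv_def by (rule DERIV_sum)

lemma has_dir_deriv_powr:
  assumes "has_dir_deriv f e d z" "f z > 0"
  shows "has_dir_deriv (\<lambda>z. f z powr a) e (a * f z powr (a - 1) * d) z"
  using assms unfolding has_dir_deriv_def
  by (intro DERIV_cong[OF DERIV_fun_powr]) auto

definition space_dir :: "'n \<Rightarrow> (real ^ 'n) \<times> real" where
  "space_dir i = (axis i 1, 0)"

definition time_dir :: "(real ^ 'n) \<times> real" where
  "time_dir = (0, 1)"

section \<open>The squared gradient as a viscosity subsolution\<close>

text \<open>The derivatives of the test function \<open>B\<close> stand in for those of the squared
  gradient, which has first spatial derivatives but neither second ones nor a time derivative in
  general. The comparison in \<open>max\<close> looks only backwards in time, as is usual for
  parabolic maximum principles.\<close>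

lemma bernstein_viscosity:
  fixes U B D F Bt :: "(real ^ 'n) \<times> real \<Rightarrow> real"
    and G F' B' B'' :: "'n \<Rightarrow> (real ^ 'n) \<times> real \<Rightarrow> real"
    and H :: "'n \<Rightarrow> 'n \<Rightarrow> (real ^ 'n) \<times> real \<Rightarrow> real"
  assumes Q: "open Q" "z1 \<in> Q"
    and U: "\<And>z i. z \<in> Q \<Longrightarrow> has_dir_deriv U (space_dir i) (G i z) z"
    and G: "\<And>z i j. z \<in> Q \<Longrightarrow> has_dir_deriv (G j) (space_dir i) (H j i z) z"
    and D: "\<And>z. z \<in> Q \<Longrightarrow> has_dir_deriv U time_dir (D z) z"
    and F: "\<And>z i. z \<in> Q \<Longrightarrow> has_dir_deriv F (space_dir i) (F' i z) z"
    and contU: "continuous_on Q U" and contG: "\<And>i. continuous_on Q (G i)"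
    and contH: "\<And>i j. continuous_on Q (H j i)" and contF: "\<And>i. continuous_on Q (F' i)"
    and eq: "\<And>z. z \<in> Q \<Longrightarrow> D z - (\<Sum>j\<in>UNIV. H j j z) = F z"
    and B: "\<And>z i. z \<in> Q \<Longrightarrow> has_dir_deriv B (space_dir i) (B' i z) z"
    and B': "\<And>z i. z \<in> Q \<Longrightarrow> has_dir_deriv (B' i) (space_dir i) (B'' i z) z"
    and Bt: "\<And>z. z \<in> Q \<Longrightarrow> has_dir_deriv B time_dir (Bt z) z"
    and contB: "continuous_on Q B" and contB'': "\<And>i. continuous_on Q (B'' i)"
    and contBt: "continuous_on Q Bt"
    and max: "\<And>z. z \<in> Q \<Longrightarrow> snd z \<le> snd z1 \<Longrightarrow>
      (\<Sum>i\<in>UNIV. (G i z)\<^sup>2) - B z \<le> (\<Sum>i\<in>UNIV. (G i z1)\<^sup>2) - B z1"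
  shows "Bt z1 - (\<Sum>j\<in>UNIV. B'' j z1)
      \<le> 2 * (\<Sum>i\<in>UNIV. G i z1 * F' i z1) - 2 * (\<Sum>i\<in>UNIV. \<Sum>j\<in>UNIV. (H j i z1)\<^sup>2)"
proof -
  define x1 t1 where "x1 = fst z1" and "t1 = snd z1"
  txt \<open>Adding \<open>P\<close> to \<open>B\<close> makes the maximum strict without changing the derivatives of \<open>B\<close> at \<open>z1\<close>
    that occur in the claim.\<close>
  define P where "P z = (\<Sum>i\<in>UNIV. (fst z $ i - x1 $ i) ^ 4) + (snd z - t1)\<^sup>2" for z :: "(real ^ 'n) \<times> real"
  define P' where "P' j z = 4 * (fst z $ j - x1 $ j) ^ 3" for j and z :: "(real ^ 'n) \<times> real"
  define P'' where "P'' j z = 12 * (fst z $ j - x1 $ j)\<^sup>2" for j and z :: "(real ^ 'n) \<times> real"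
  define Pt where "Pt z = 2 * (snd z - t1)" for z :: "(real ^ 'n) \<times> real"
  have P: "has_dir_deriv P (space_dir j) (P' j z) z" for j z
  proof -
    have "((\<lambda>s. (fst (z + s *\<^sub>R space_dir j) $ i - x1 $ i) ^ 4) has_real_derivative
        (if i = j then P' j z else 0)) (at 0)" for i
      by (auto simp: space_dir_def P'_def axis_def intro!: derivative_eq_intros)
    then have "((\<lambda>s. (\<Sum>i\<in>UNIV. (fst (z + s *\<^sub>R space_dir j) $ i - x1 $ i) ^ 4)) has_real_derivative
        (\<Sum>i\<in>UNIV. if i = j then P' j z else 0)) (at 0)"
      by (intro DERIV_sum) auto
    moreover have "((\<lambda>s. (snd (z + s *\<^sub>R space_dir j) - t1)\<^sup>2) has_real_derivative 0) (at 0)"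
      by (simp add: space_dir_def)
    ultimately show ?thesis
      unfolding has_dir_deriv_def P_def using DERIV_add by fastforce
  qed
  have P': "has_dir_deriv (P' j) (space_dir j) (P'' j z) z" for j z
    by (auto simp: has_dir_deriv_def P'_def P''_def space_dir_def axis_def intro!: derivative_eq_intros)
  have Pt: "has_dir_deriv P time_dir (Pt z) z" for z
    by (auto simp: has_dir_deriv_def P_def Pt_def time_dir_def intro!: derivative_eq_intros)
  have P_pos: "P z > 0" if "z \<noteq> z1" for z
  proof (cases "snd z = t1")
    case False
    then show ?thesis unfolding P_def by (intro add_nonneg_pos sum_nonneg) auto
  next
    case True
    then have "fst z \<noteq> x1" using that by (auto simp: x1_def t1_def prod_eq_iff)
    then obtain i where "fst z $ i \<noteq> x1 $ i" by (auto simp: vec_eq_iff)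
    then have "(\<Sum>i\<in>UNIV. (fst z $ i - x1 $ i) ^ 4) > 0"
      by (intro sum_pos2[of UNIV i]) auto
    then show ?thesis unfolding P_def by (intro add_pos_nonneg) auto
  qed
  have P0: "P z1 = 0" by (simp add: P_def x1_def t1_def)

  define S where "S z = (\<Sum>i\<in>UNIV. (G i z)\<^sup>2) - (B z + P z)" for z
  have strict: "S z < S z1" if "z \<in> Q" "snd z \<le> t1" "z \<noteq> z1" for z
    using max[of z] that P_pos[of z] P0 by (simp add: S_def t1_def)

  obtain r0 where r0: "r0 > 0" "ball z1 r0 \<subseteq> Q"
    using Q open_contains_ball by blast
  \<comment> \<open>A quarter leaves room for points of \<open>K\<close>, which are within
    \<open>r\<close> of \<open>z1\<close> in space and in time, and for a spatial shift by less than
    \<open>r\<close>: in total at most \<open>3 * r < r0\<close>.\<close>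
  define r where "r = r0 / 4"
  have r: "r > 0" using r0 by (simp add: r_def)
  have inQ: "(x, t) \<in> Q" if "dist x x1 \<le> 2 * r" "dist t t1 \<le> r" for x t
  proof -
    have "dist (x, t) z1 \<le> dist x x1 + dist t t1"
      using sqrt_sum_squares_le_sum[of "dist x x1" "dist t t1"] 
      by (simp add: dist_prod_def x1_def t1_def)
    then have "dist (x, t) z1 < r0" using that r0 by (simp add: r_def)
    then show ?thesis using r0(2) by (auto simp: dist_commute)
  qed
  define K where "K = cball x1 r \<times> {t1 - r..t1}"
  have K: "compact K" "z1 \<in> K"
    using r by (auto simp: K_def x1_def t1_def mem_Times_iff intro!: compact_Times)
  \<comment> \<open>Two successors make \<open>h n < r\<close> strict also for
    \<open>n = 0\<close>.\<close>
  define h where "h n = r / real (Suc (Suc n))" for n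
  have h: "h n > 0" "h n < r" for n
  proof -
    show "h n > 0" using r by (simp add: h_def)
    have "r * 1 < r * real (Suc (Suc n))" using r by (intro mult_strict_left_mono) auto
    then show "h n < r" by (simp add: h_def pos_divide_less_eq)
  qed
  have h0: "h \<longlonglongrightarrow> 0"
    unfolding h_def using LIMSEQ_Suc[OF LIMSEQ_Suc[OF lim_const_over_n[of r]]] by simp
  have tri: "dist (a + b + c) x \<le> dist a x + norm b + norm c" for a b c x :: "real ^ 'n"
    unfolding dist_norm by norm
  have shift: "z + s *\<^sub>R space_dir i + k *\<^sub>R space_dir j \<in> Q"
    if "dist (fst z) x1 + \<bar>s\<bar> + \<bar>k\<bar> \<le> 2 * r" "dist (snd z) t1 \<le> r" for z s i k j
  proof -
    have "dist (fst z + s *\<^sub>R axis i 1 + k *\<^sub>R axis j 1) x1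
        \<le> dist (fst z) x1 + norm (s *\<^sub>R axis i 1 :: real ^ 'n) + norm (k *\<^sub>R axis j 1 :: real ^ 'n)"
      by (rule tri)
    then have "dist (fst z + s *\<^sub>R axis i 1 + k *\<^sub>R axis j 1) x1 \<le> 2 * r"
      using that by (simp add: norm_axis_1)
    from inQ[OF this that(2)] show ?thesis by (simp add: space_dir_def plus_prod_def)
  qed
  have shift1: "z + k *\<^sub>R space_dir j \<in> Q"
    if "dist (fst z) x1 + \<bar>k\<bar> \<le> 2 * r" "dist (snd z) t1 \<le> r" for z k j
    using shift[of z 0 k j j] that by simp
  have KQ: "z \<in> Q" if "z \<in> K" for z
    using shift1[of z 0] that r by (auto simp: K_def dist_commute dist_real_def)
  have KQh: "z + h n *\<^sub>R space_dir i \<in> Q" if "z \<in> K" for z i n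
    using that h[of n] by (intro shift1) (auto simp: K_def dist_commute dist_real_def)

  txt \<open>The difference quotients have the regularity of \<open>u\<close>, so the classical maximum principle
    applies to \<open>Z n\<close>; its maximum points converge to the strict maximum \<open>z1\<close>.\<close>
  define q where "q f n i z = (f (z + h n *\<^sub>R space_dir i) - f z) / h n"
    for f :: "(real ^ 'n) \<times> real \<Rightarrow> real" and n i z
  define Z where "Z n z = (\<Sum>i\<in>UNIV. (q U n i z)\<^sup>2) - (B z + P z)" for n z
  have contP: "continuous_on A P" for A
    unfolding P_def by (intro continuous_intros)
  have "continuous_on K (Z n)" for n
  proof -
    have "continuous_on K (\<lambda>z. U (z + h n *\<^sub>R space_dir i))" for i
      by (rule continuous_on_compose2[OF contU]) (auto intro!: continuous_intros KQh)
    then show ?thesis unfolding Z_def q_def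
      using KQ h(1)[of n]
      by (intro continuous_intros contP) 
        (auto intro: continuous_on_subset[OF contU] continuous_on_subset[OF contB])
  qed
  then have "\<exists>z\<in>K. \<forall>y\<in>K. Z n y \<le> Z n z" for n
    using K by (intro continuous_attains_sup) auto
  then obtain X where X: "\<And>n. X n \<in> K" "\<And>n y. y \<in> K \<Longrightarrow> Z n y \<le> Z n (X n)"
    by metis
  obtain zl \<sigma> where zl: "zl \<in> K" "strict_mono \<sigma>" "(X \<circ> \<sigma>) \<longlonglongrightarrow> zl"
    using K(1) X(1) unfolding compact_def by blast
  have h\<sigma>: "(\<lambda>n. h (\<sigma> n)) \<longlonglongrightarrow> 0"
    using LIMSEQ_subseq_LIMSEQ[OF h0 zl(2)] by (simp add: o_def)
  have q_lim: "(\<lambda>n. q f (\<sigma> n) i (Y n)) \<longlonglongrightarrow> f' z"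
    if "\<And>z. z \<in> Q \<Longrightarrow> has_dir_deriv f (space_dir i) (f' z) z" "continuous_on Q f'" "Y \<longlonglongrightarrow> z" "z \<in> Q"
    for f f' Y z i
    unfolding q_def using dir_quotient_tendsto[OF Q(1) that(4,1,2,3) h\<sigma> h(1)] by simp
  have Z_lim: "(\<lambda>n. Z (\<sigma> n) (Y n)) \<longlonglongrightarrow> S z" if "Y \<longlonglongrightarrow> z" "z \<in> Q" for Y z
  proof -
    have "isCont B z" using contB Q that continuous_on_eq_continuous_at by blast
    moreover have "isCont P z" using contP[of UNIV] continuous_on_eq_continuous_at[of UNIV P] by blast
    ultimately show ?thesis
      unfolding Z_def S_def using that
      by (intro tendsto_intros q_lim[OF U contG] isCont_tendsto_compose[of _ B] isCont_tendsto_compose[of _ P])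
  qed
  \<comment> \<open>Passing to the limit in the maximality of \<open>X\<close>, tested against
    \<open>z1\<close>, shows that \<open>S zl\<close> is at least \<open>S z1\<close>; strictness
    leaves only \<open>z1\<close>.\<close>
  have "zl = z1"
  proof (rule ccontr)
    assume "zl \<noteq> z1"
    then have "S zl < S z1" using zl(1) KQ by (intro strict) (auto simp: K_def)
    moreover have "S z1 \<le> S zl"
    proof (rule LIMSEQ_le)
      show "(\<lambda>n. Z (\<sigma> n) z1) \<longlonglongrightarrow> S z1" using Q by (intro Z_lim) auto
      show "(\<lambda>n. Z (\<sigma> n) ((X \<circ> \<sigma>) n)) \<longlonglongrightarrow> S zl" by (rule Z_lim[OF zl(3) KQ[OF zl(1)]])
    qed (use X K in auto)
    ultimately show False by simp
  qed
  define Y where "Y n = X (\<sigma> n)" for n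
  have Y: "Y \<longlonglongrightarrow> z1" using zl(3) \<open>zl = z1\<close> by (simp add: Y_def[abs_def] o_def)

  define lhs where "lhs n = Bt (Y n) + Pt (Y n) - (\<Sum>j\<in>UNIV. B'' j (Y n) + P'' j (Y n))" for n
  define rhs where "rhs n = 2 * (\<Sum>i\<in>UNIV. q U (\<sigma> n) i (Y n) * q F (\<sigma> n) i (Y n))
      - 2 * (\<Sum>i\<in>UNIV. \<Sum>j\<in>UNIV. (q (G j) (\<sigma> n) i (Y n))\<^sup>2)" for n
  \<comment> \<open>The maximum point has to avoid the lateral boundary and the bottom of
    \<open>K\<close>. It may lie on the top, where the one-sided time condition is still
    available.\<close>
  have ineq: "lhs n \<le> rhs n" if near: "dist (fst (Y n)) x1 < r" "snd (Y n) > t1 - r" for n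
  proof -
    define m where "m = \<sigma> n"
    define y where "y = Y n"
    have yK: "y \<in> K" using X by (simp add: y_def Y_def)
    have ymax: "Z m z \<le> Z m y" if "z \<in> K" for z using X(2)[OF that] by (simp add: y_def Y_def m_def)
    \<comment> \<open>Differentiation commutes with translation, so the derivative of a quotient is
      the quotient of the derivative. This is how third derivatives of \<open>u\<close> are
      avoided.\<close>
    have nq: "has_dir_deriv (q f m i) e (q f' m i z) z"
      if "z \<in> K" and f: "\<And>z. z \<in> Q \<Longrightarrow> has_dir_deriv f e (f' z) z" for f f' e i z
      unfolding q_def using KQ[OF that(1)] KQh[OF that(1)]
      by (intro has_dir_deriv_divide_const has_dir_deriv_diff has_dir_deriv_shift f)
    have sq: "has_dir_deriv (\<lambda>z. (q f m i z)\<^sup>2) e (2 * (q f m i z * q f' m i z)) z"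
      if "z \<in> K" "\<And>z. z \<in> Q \<Longrightarrow> has_dir_deriv f e (f' z) z" for f f' e i z
      using has_dir_deriv_power[OF nq[OF that], of i 2] by (simp add: mult_ac)
    have space: "(\<Sum>i\<in>UNIV. 2 * (q (G j) m i y)\<^sup>2 + 2 * q U m i y * q (H j j) m i y) \<le> B'' j y + P'' j y" for j
    proof -
      define \<delta> where "\<delta> = r - dist (fst y) x1"
      have \<delta>: "\<delta> > 0" using near by (simp add: \<delta>_def y_def)
      have lineK: "y + s *\<^sub>R space_dir j \<in> K" if "\<bar>s\<bar> < \<delta>" for s
      proof -
        have "dist (fst y + s *\<^sub>R axis j 1) x1 \<le> dist (fst y) x1 + norm (s *\<^sub>R axis j 1 :: real ^ 'n)"
          by (rule tri[of _ _ 0, simplified])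
        then have "dist (fst y + s *\<^sub>R axis j 1) x1 \<le> r"
          using that by (simp add: norm_axis_1 \<delta>_def)
        then show ?thesis using yK 
          by (auto simp: K_def space_dir_def mem_Times_iff dist_commute)
      qed
      define Z' where "Z' z = (\<Sum>i\<in>UNIV. 2 * (q U m i z * q (G j) m i z)) - (B' j z + P' j z)" for z
      have d1: "has_dir_deriv (Z m) (space_dir j) (Z' z) z" if "z \<in> K" for z
        unfolding Z_def Z'_def
      proof (intro has_dir_deriv_diff has_dir_deriv_add B P has_dir_deriv_sum)
        show "has_dir_deriv (\<lambda>z. (q U m i z)\<^sup>2) (space_dir j) (2 * (q U m i z * q (G j) m i z)) z" for i
          by (rule sq[OF that U])
      qed (use KQ that in auto)
      have d2: "has_dir_deriv Z' (space_dir j)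
          ((\<Sum>i\<in>UNIV. 2 * (q (G j) m i y)\<^sup>2 + 2 * q U m i y * q (H j j) m i y) - (B'' j y + P'' j y)) y"
        unfolding Z'_def
      proof (intro has_dir_deriv_diff has_dir_deriv_add B' P' has_dir_deriv_sum)
        show "has_dir_deriv (\<lambda>z. 2 * (q U m i z * q (G j) m i z)) (space_dir j)
            (2 * (q (G j) m i y)\<^sup>2 + 2 * q U m i y * q (H j j) m i y) y" for i
          using has_dir_deriv_cmult[OF has_dir_deriv_mult[OF nq[OF yK U] nq[OF yK G]], where c = 2]
          by (simp add: algebra_simps power2_eq_square)
      qed (use KQ yK in auto)
      have "(\<Sum>i\<in>UNIV. 2 * (q (G j) m i y)\<^sup>2 + 2 * q U m i y * q (H j j) m i y) - (B'' j y + P'' j y) \<le> 0"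
      proof (rule second_deriv_nonpos_at_max[OF \<delta>])
        show "((\<lambda>s. Z m (y + s *\<^sub>R space_dir j)) has_real_derivative Z' (y + s *\<^sub>R space_dir j)) (at s)"
          if "\<bar>s\<bar> < \<delta>" for s
          using lineK[OF that] by (intro has_dir_deriv_line d1)
        show "((\<lambda>s. Z' (y + s *\<^sub>R space_dir j)) has_real_derivative
            ((\<Sum>i\<in>UNIV. 2 * (q (G j) m i y)\<^sup>2 + 2 * q U m i y * q (H j j) m i y) - (B'' j y + P'' j y))) (at 0)"
          using d2 by (simp add: has_dir_deriv_def)
        show "Z m (y + s *\<^sub>R space_dir j) \<le> Z m (y + 0 *\<^sub>R space_dir j)" if "\<bar>s\<bar> < \<delta>" for s
          using ymax[OF lineK[OF that]] by simp
      qed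
      then show ?thesis by simp
    qed
    have time: "(\<Sum>i\<in>UNIV. 2 * (q U m i y * q D m i y)) - (Bt y + Pt y) \<ge> 0"
    proof (rule deriv_nonneg_at_left_max)
      show "snd y - (t1 - r) > 0" using near by (simp add: y_def)
      have "has_dir_deriv (Z m) time_dir ((\<Sum>i\<in>UNIV. 2 * (q U m i y * q D m i y)) - (Bt y + Pt y)) y"
        unfolding Z_def
      proof (intro has_dir_deriv_diff has_dir_deriv_add Bt Pt has_dir_deriv_sum)
        show "has_dir_deriv (\<lambda>z. (q U m i z)\<^sup>2) time_dir (2 * (q U m i y * q D m i y)) y" for i
          by (rule sq[OF yK D])
      qed (use KQ yK in auto)
      then show "((\<lambda>s. Z m (y + s *\<^sub>R time_dir)) has_real_derivative
          ((\<Sum>i\<in>UNIV. 2 * (q U m i y * q D m i y)) - (Bt y + Pt y))) (at 0)"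
        by (simp add: has_dir_deriv_def)
      show "Z m (y + s *\<^sub>R time_dir) \<le> Z m (y + 0 *\<^sub>R time_dir)"
        if "- (snd y - (t1 - r)) < s" "s \<le> 0" for s
      proof -
        have "y + s *\<^sub>R time_dir \<in> K"
          using that yK by (auto simp: K_def time_dir_def mem_Times_iff)
        then show ?thesis using ymax by simp
      qed
    qed
    \<comment> \<open>The left-hand side of the equation is linear with constant coefficients, so
      the equation passes to difference quotients.\<close>
    have qeq: "q D m i y - (\<Sum>j\<in>UNIV. q (H j j) m i y) = q F m i y" for i
    proof -
      have "q D m i y - (\<Sum>j\<in>UNIV. q (H j j) m i y) =
        ((D (y + h m *\<^sub>R space_dir i) - (\<Sum>j\<in>UNIV. H j j (y + h m *\<^sub>R space_dir i)))
          - (D y - (\<Sum>j\<in>UNIV. H j j y))) / h m"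
        by (simp add: q_def sum_divide_distrib[symmetric] sum_subtractf diff_divide_distrib)
      then show ?thesis using eq KQ[OF yK] KQh[OF yK] by (simp add: q_def)
    qed
    have "(\<Sum>j\<in>UNIV. \<Sum>i\<in>UNIV. 2 * (q (G j) m i y)\<^sup>2 + 2 * q U m i y * q (H j j) m i y)
        \<le> (\<Sum>j\<in>UNIV. B'' j y + P'' j y)"
      by (intro sum_mono space)
    moreover have "(\<Sum>j\<in>UNIV. \<Sum>i\<in>UNIV. 2 * (q (G j) m i y)\<^sup>2 + 2 * q U m i y * q (H j j) m i y)
      = 2 * (\<Sum>i\<in>UNIV. \<Sum>j\<in>UNIV. (q (G j) m i y)\<^sup>2)
        + (\<Sum>i\<in>UNIV. 2 * (q U m i y * (\<Sum>j\<in>UNIV. q (H j j) m i y)))"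
      by (subst sum.swap) (simp add: sum.distrib sum_distrib_left mult.assoc)
    \<comment> \<open>The quotients of \<open>D\<close> and of \<open>H j j\<close> need not
      converge. They enter only in this combination, which the equation turns into quotients of
      \<open>F\<close>, and those do converge.\<close>
    moreover have "(\<Sum>i\<in>UNIV. 2 * (q U m i y * q D m i y))
        - (\<Sum>i\<in>UNIV. 2 * (q U m i y * (\<Sum>j\<in>UNIV. q (H j j) m i y)))
        = 2 * (\<Sum>i\<in>UNIV. q U m i y * q F m i y)"
      by (simp add: qeq[symmetric] sum_subtractf[symmetric] sum_distrib_left right_diff_distrib)
    ultimately show ?thesis using time by (simp add: lhs_def rhs_def m_def y_def)
  qed
  have cont_at: "(\<lambda>n. f (Y n)) \<longlonglongrightarrow> f z1" if "continuous_on Q f" for f :: "_ \<Rightarrow> real"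
    using that Q Y continuous_on_eq_continuous_at isCont_tendsto_compose by blast
  have Pconts: "continuous_on Q Pt" "continuous_on Q (P'' j)" for j
    unfolding Pt_def P''_def by (intro continuous_intros)+
  have "lhs \<longlonglongrightarrow> Bt z1 + Pt z1 - (\<Sum>j\<in>UNIV. B'' j z1 + P'' j z1)"
    unfolding lhs_def[abs_def] by (intro tendsto_intros cont_at contBt contB'' Pconts)
  moreover have "rhs \<longlonglongrightarrow> 2 * (\<Sum>i\<in>UNIV. G i z1 * F' i z1) - 2 * (\<Sum>i\<in>UNIV. \<Sum>j\<in>UNIV. (H j i z1)\<^sup>2)"
    unfolding rhs_def[abs_def]
    by (intro tendsto_intros q_lim[OF U contG Y Q(2)] q_lim[OF F contF Y Q(2)] q_lim[OF G contH Y Q(2)])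
  moreover have "\<forall>\<^sub>F n in sequentially. lhs n \<le> rhs n"
  proof -
    have "(\<lambda>n. fst (Y n)) \<longlonglongrightarrow> x1" "(\<lambda>n. snd (Y n)) \<longlonglongrightarrow> t1"
      using Y by (auto simp: x1_def t1_def intro!: tendsto_intros)
    then have "\<forall>\<^sub>F n in sequentially. dist (fst (Y n)) x1 < r"
      "\<forall>\<^sub>F n in sequentially. snd (Y n) > t1 - r"
      using r by (auto intro: tendstoD order_tendstoD)
    then show ?thesis by eventually_elim (rule ineq)
  qed
  ultimately have "Bt z1 + Pt z1 - (\<Sum>j\<in>UNIV. B'' j z1 + P'' j z1)
      \<le> 2 * (\<Sum>i\<in>UNIV. G i z1 * F' i z1) - 2 * (\<Sum>i\<in>UNIV. \<Sum>j\<in>UNIV. (H j i z1)\<^sup>2)"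
    by (intro tendsto_le[OF sequentially_bot]) 
  then show ?thesis by (simp add: Pt_def P''_def x1_def t1_def)
qed

section \<open>The differential inequality for classical solutions\<close>

lemma gradient_dir_deriv:
  fixes f :: "real ^ 'n \<Rightarrow> real"
  assumes "f differentiable (at x)"
  shows "((\<lambda>s. f (x + s *\<^sub>R axis i 1)) has_real_derivative gradient f x $ i) (at 0)"
proof -
  let ?f' = "frechet_derivative f (at x)"
  have f': "(f has_derivative ?f') (at x)"
    using assms frechet_derivative_works by blast
  have "((\<lambda>s. x + s *\<^sub>R axis i 1) has_derivative (\<lambda>s. s *\<^sub>R axis i 1)) (at 0)"
    by (auto intro!: derivative_eq_intros)
  from has_derivative_compose[OF this, of f ?f'] f'
  have "((\<lambda>s. f (x + s *\<^sub>R axis i 1)) has_derivative (\<lambda>s. ?f' (s *\<^sub>R axis i 1))) (at 0)"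
    by simp
  moreover have "(\<lambda>s. ?f' (s *\<^sub>R axis i 1)) = (*) (gradient f x $ i)"
    by (simp add: fun_eq_iff gradient_def linear_scale[OF has_derivative_linear[OF f']])
  ultimately show ?thesis
    by (simp add: has_field_derivative_def)
qed

lemma differentiable_vec_nth:
  fixes f :: "'a::real_normed_vector \<Rightarrow> real ^ 'n"
  assumes "f differentiable (at x)"
  shows "(\<lambda>y. f y $ i) differentiable (at x)"
  using assms bounded_linear.has_derivative[OF bounded_linear_vec_nth]
  unfolding differentiable_def by blast

text \<open>Cauchy--Schwarz on the diagonal, after which the off-diagonal squares only enlarge the
  right-hand side. For the Hessian it bounds the squared Laplacian.\<close>

lemma sum_diagonal_squares_le:
  fixes a :: "'n::finite \<Rightarrow> 'n \<Rightarrow> real"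
  shows "(\<Sum>i\<in>UNIV. a i i)\<^sup>2 \<le> real CARD('n) * (\<Sum>i\<in>UNIV. \<Sum>j\<in>UNIV. (a j i)\<^sup>2)"
proof -
  have "(\<Sum>i\<in>UNIV. a i i)\<^sup>2 \<le> real CARD('n) * (\<Sum>i\<in>UNIV. (a i i)\<^sup>2)"
    using sum_squared_le_sum_of_squares[of "\<lambda>i. a i i" "UNIV :: 'n set"] by (simp add: mult.commute)
  also have "\<dots> \<le> real CARD('n) * (\<Sum>i\<in>UNIV. \<Sum>j\<in>UNIV. (a j i)\<^sup>2)"
    by (intro mult_left_mono sum_mono member_le_sum) auto
  finally show ?thesis .
qed

lemma open_cylinder: "open (cylinder x0 R T)"
  unfolding cylinder_def by (intro open_Times) auto

definition ugrad :: "(real ^ 'n \<Rightarrow> real \<Rightarrow> real) \<Rightarrow> (real ^ 'n) \<times> real \<Rightarrow> real ^ 'n" where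
  "ugrad u z = gradient (\<lambda>y. u y (snd z)) (fst z)"

definition uhess :: "(real ^ 'n \<Rightarrow> real \<Rightarrow> real) \<Rightarrow> (real ^ 'n) \<times> real \<Rightarrow> real ^ 'n ^ 'n" where
  "uhess u z = hessian (\<lambda>y. u y (snd z)) (fst z)"

lemma C21_on_derivs:
  fixes u :: "real ^ 'n \<Rightarrow> real \<Rightarrow> real"
  assumes "C21_on Q u"
  shows "z \<in> Q \<Longrightarrow> has_dir_deriv (\<lambda>z. u (fst z) (snd z)) (space_dir i) (ugrad u z $ i) z"
    and "z \<in> Q \<Longrightarrow> has_dir_deriv (\<lambda>z. ugrad u z $ j) (space_dir i) (uhess u z $ j $ i) z"
    and "z \<in> Q \<Longrightarrow> has_dir_deriv (\<lambda>z. u (fst z) (snd z)) time_dir (deriv (u (fst z)) (snd z)) z"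
    and "continuous_on Q (\<lambda>z. u (fst z) (snd z))"
    and "continuous_on Q (ugrad u)"
    and "continuous_on Q (uhess u)"
proof -
  note C21 = assms[unfolded C21_on_def case_prod_unfold]
  show "continuous_on Q (\<lambda>z. u (fst z) (snd z))" "continuous_on Q (ugrad u)" "continuous_on Q (uhess u)"
    unfolding ugrad_def[abs_def] uhess_def[abs_def] using C21 by blast+
  assume "z \<in> Q"
  then have d: "(\<lambda>y. u y (snd z)) differentiable (at (fst z))"
    "gradient (\<lambda>y. u y (snd z)) differentiable (at (fst z))"
    "u (fst z) differentiable (at (snd z))"
    using C21 by blast+
  show "has_dir_deriv (\<lambda>z. u (fst z) (snd z)) (space_dir i) (ugrad u z $ i) z"
    using gradient_dir_deriv[OF d(1)] by (simp add: has_dir_deriv_def space_dir_def ugrad_def)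
  show "has_dir_deriv (\<lambda>z. ugrad u z $ j) (space_dir i) (uhess u z $ j $ i) z"
    using gradient_dir_deriv[OF differentiable_vec_nth[OF d(2)]]
    by (simp add: has_dir_deriv_def space_dir_def ugrad_def uhess_def hessian_def)
  have "(u (fst z) has_real_derivative deriv (u (fst z)) (snd z)) (at (snd z))"
    using d(3) by (simp add: DERIV_deriv_iff_real_differentiable)
  then have "((\<lambda>s. u (fst z) (s + snd z)) has_real_derivative deriv (u (fst z)) (snd z)) (at 0)"
    using DERIV_shift[of "u (fst z)" "deriv (u (fst z)) (snd z)" 0 "snd z"] by (simp only: add_0_left)
  moreover have "fst (z + s *\<^sub>R time_dir) = fst z" "snd (z + s *\<^sub>R time_dir) = s + snd z" for s
    by (simp_all add: time_dir_def)
  ultimately show "has_dir_deriv (\<lambda>z. u (fst z) (snd z)) time_dir (deriv (u (fst z)) (snd z)) z"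
    by (simp only: has_dir_deriv_def)
qed

lemma dir_deriv_zero_at_max:
  assumes "has_dir_deriv f e d z" "open Q" "z \<in> Q"
    and "\<And>s. z + s *\<^sub>R e \<in> Q \<Longrightarrow> f (z + s *\<^sub>R e) \<le> f z"
  shows "d = 0"
proof -
  have "((\<lambda>s::real. z + s *\<^sub>R e) \<longlongrightarrow> z + 0 *\<^sub>R e) (nhds 0)"
    by (intro tendsto_intros) (simp add: filterlim_ident)
  then have "\<forall>\<^sub>F s::real in nhds 0. z + s *\<^sub>R e \<in> Q"
    using assms(2,3) by (simp add: topological_tendstoD)
  then obtain r :: real where r: "r > 0" "\<And>s. \<bar>s\<bar> < r \<Longrightarrow> z + s *\<^sub>R e \<in> Q"
    by (auto simp: eventually_nhds_metric dist_real_def)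
  have max: "\<forall>s. \<bar>0 - s\<bar> < r \<longrightarrow> f (z + s *\<^sub>R e) \<le> f (z + 0 *\<^sub>R e)"
  proof (intro allI impI)
    fix s :: real assume "\<bar>0 - s\<bar> < r"
    then have "z + s *\<^sub>R e \<in> Q" by (intro r(2)) simp
    then show "f (z + s *\<^sub>R e) \<le> f (z + 0 *\<^sub>R e)" using assms(4) by simp
  qed
  show ?thesis
    by (rule DERIV_local_max[OF assms(1)[unfolded has_dir_deriv_def] r(1) max])
qed

text \<open>At the touching point the gradients of \<open>w\<close> and \<open>B\<close> agree, so
  the Hessian terms coming from the gradient nonlinearity can be expressed through
  \<open>B'\<close>. The remaining square of the Hessian is bounded below by that of the Laplacian,
  which the equation expresses through the time derivative and the two nonlinear terms.\<close>

lemma solution_viscosity: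
  fixes u :: "real ^ 'n \<Rightarrow> real \<Rightarrow> real" and p q M :: real
  assumes sol: "nonneg_classical_solution p q M Q u" and "open Q"
    and "open A" "z1 \<in> Q" "z1 \<in> A" "ugrad u z1 \<noteq> 0"
    and B: "\<And>z i. z \<in> A \<Longrightarrow> has_dir_deriv B (space_dir i) (B' i z) z"
    and B': "\<And>z i. z \<in> A \<Longrightarrow> has_dir_deriv (B' i) (space_dir i) (B'' i z) z"
    and Bt: "\<And>z. z \<in> A \<Longrightarrow> has_dir_deriv B time_dir (Bt z) z"
    and contB: "continuous_on A B" and contB'': "\<And>i. continuous_on A (B'' i)"
    and contBt: "continuous_on A Bt"
    and max: "\<And>z. z \<in> Q \<Longrightarrow> z \<in> A \<Longrightarrow> snd z \<le> snd z1 \<Longrightarrow>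
      (norm (ugrad u z))\<^sup>2 - B z \<le> (norm (ugrad u z1))\<^sup>2 - B z1"
  defines "v \<equiv> u (fst z1) (snd z1)" and "g \<equiv> norm (ugrad u z1)"
  shows "v > 0"
    and "Bt z1 - (\<Sum>j\<in>UNIV. B'' j z1) \<le> 2 * p * v powr (p - 1) * g\<^sup>2
      + q * M * g powr (q - 2) * (\<Sum>i\<in>UNIV. ugrad u z1 $ i * B' i z1)
      - 2 / real CARD('n) * (deriv (u (fst z1)) (snd z1) - v powr p - M * g powr q)\<^sup>2"
proof -
  define U where "U z = u (fst z) (snd z)" for z
  define G where "G i z = ugrad u z $ i" for i z
  define H where "H j i z = uhess u z $ j $ i" for i j z
  define D where "D z = deriv (u (fst z)) (snd z)" for z
  define W where "W z = (\<Sum>i\<in>UNIV. (G i z)\<^sup>2)" for z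
  \<comment> \<open>Writing the gradient term as a power of \<open>W\<close> makes it differentiable
    by the power rule wherever \<open>W\<close> is positive.\<close>
  define F where "F z = U z powr p + M * W z powr (q / 2)" for z
  define F' where "F' i z = p * U z powr (p - 1) * G i z
      + M * (q / 2 * W z powr (q / 2 - 1) * (\<Sum>j\<in>UNIV. 2 * (G j z * H j i z)))" for i z
  note sol' = sol[unfolded nonneg_classical_solution_def]
  have C21: "C21_on Q u" by (rule conjunct1[OF sol'])
  have eqs: "U z \<ge> 0 \<and> D z - (\<Sum>j\<in>UNIV. H j j z) = U z powr p + M * norm (ugrad u z) powr q"
    if "z \<in> Q" for z
    using bspec[OF conjunct2[OF sol'] that]
    unfolding case_prod_unfold U_def D_def H_def ugrad_def uhess_def laplacian_def .
  have U_nonneg: "U z \<ge> 0" if "z \<in> Q" for z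
    using eqs[OF that] by (rule conjunct1)
  have eq: "D z - (\<Sum>j\<in>UNIV. H j j z) = U z powr p + M * norm (ugrad u z) powr q" if "z \<in> Q" for z
    using eqs[OF that] by (rule conjunct2)
  note reg = C21_on_derivs[OF C21, folded U_def G_def H_def D_def]
  have contG: "continuous_on Q (G i)" and contH: "continuous_on Q (H j i)" for i j
    using reg(5,6) by (auto simp: G_def[abs_def] H_def[abs_def] intro!: continuous_intros)
  have W: "W z = (norm (ugrad u z))\<^sup>2" for z
    by (simp add: W_def G_def norm_vec_def L2_set_def sum_nonneg)
  have contW: "continuous_on Q W"
    unfolding W_def by (intro continuous_intros contG)
  have Wpow: "W z powr a = norm (ugrad u z) powr (2 * a)" for z a
    by (cases "ugrad u z = 0") (auto simp: W powr_powr[symmetric])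
  have W': "has_dir_deriv W (space_dir i) (\<Sum>j\<in>UNIV. 2 * (G j z * H j i z)) z" if "z \<in> Q" for z i
  proof -
    have "has_dir_deriv (\<lambda>z. (G j z)\<^sup>2) (space_dir i) (2 * (G j z * H j i z)) z" for j
      using has_dir_deriv_power[OF reg(2)[OF that], of j 2 i] by (simp add: mult_ac)
    then show ?thesis unfolding W_def by (intro has_dir_deriv_sum)
  qed

  have "W z1 > 0" using assms(6) by (simp add: W)
  txt \<open>An interior zero of \<open>u \<ge> 0\<close> is a minimum, where the gradient vanishes; so both powers in the
    equation are differentiable near \<open>z1\<close>.\<close>
  have "U z1 \<noteq> 0"
  proof
    assume "U z1 = 0"
    have "- G i z1 = 0" for i
    proof (rule dir_deriv_zero_at_max[OF _ \<open>open Q\<close> \<open>z1 \<in> Q\<close>])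
      show "has_dir_deriv (\<lambda>z. 0 - U z) (space_dir i) (- G i z1) z1"
        using has_dir_deriv_diff[OF has_dir_deriv_const reg(1)[OF \<open>z1 \<in> Q\<close>], of 0 i]
        by (simp only: diff_0)
    qed (use U_nonneg \<open>U z1 = 0\<close> in simp)
    then show False using assms(6) by (simp add: G_def vec_eq_iff)
  qed
  then have "U z1 > 0" using U_nonneg[OF \<open>z1 \<in> Q\<close>] by simp
  then show "v > 0" by (simp add: U_def v_def)

  define Q' where "Q' = (Q \<inter> A) \<inter> {z \<in> Q. 0 < U z} \<inter> {z \<in> Q. 0 < W z}"
  have "open Q'"
  proof -
    have "open {z \<in> Q. 0 < f z}" if "continuous_on Q f" for f :: "_ \<Rightarrow> real"
      using continuous_open_preimage[OF that \<open>open Q\<close> open_greaterThan, of 0]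
      by (simp add: vimage_def Int_def)
    then show ?thesis unfolding Q'_def using \<open>open Q\<close> \<open>open A\<close> reg(4) contW by blast
  qed
  have z1: "z1 \<in> Q'"
    using assms(4,5) \<open>U z1 > 0\<close> \<open>W z1 > 0\<close> by (simp add: Q'_def)
  have Q': "z \<in> Q" "z \<in> A" "U z > 0" "W z > 0" if "z \<in> Q'" for z
    using that by (auto simp: Q'_def)
  have sub: "Q' \<subseteq> Q" "Q' \<subseteq> A" using Q' by auto
  have F': "has_dir_deriv F (space_dir i) (F' i z) z" if "z \<in> Q'" for z i
    unfolding F_def F'_def
    by (intro has_dir_deriv_add has_dir_deriv_cmult has_dir_deriv_powr reg(1) W' Q'[OF that])
  have nz: "\<forall>z\<in>Q'. U z \<noteq> 0" "\<forall>z\<in>Q'. W z \<noteq> 0"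
    using Q' by (metis less_irrefl)+
  have contF: "continuous_on Q' (F' i)" for i
    unfolding F'_def
    by (intro continuous_intros nz continuous_on_subset[OF reg(4) sub(1)] continuous_on_subset[OF contG sub(1)]
        continuous_on_subset[OF contH sub(1)] continuous_on_subset[OF contW sub(1)])
  have "Bt z1 - (\<Sum>j\<in>UNIV. B'' j z1)
      \<le> 2 * (\<Sum>i\<in>UNIV. G i z1 * F' i z1) - 2 * (\<Sum>i\<in>UNIV. \<Sum>j\<in>UNIV. (H j i z1)\<^sup>2)"
  proof (rule bernstein_viscosity[OF \<open>open Q'\<close> z1 reg(1)[OF Q'(1)] reg(2)[OF Q'(1)] reg(3)[OF Q'(1)] F'
        continuous_on_subset[OF reg(4) sub(1)] continuous_on_subset[OF contG sub(1)]
        continuous_on_subset[OF contH sub(1)] contF _ B[OF Q'(2)] B'[OF Q'(2)] Bt[OF Q'(2)]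
        continuous_on_subset[OF contB sub(2)] continuous_on_subset[OF contB'' sub(2)]
        continuous_on_subset[OF contBt sub(2)]])
    show "D z - (\<Sum>j\<in>UNIV. H j j z) = F z" if "z \<in> Q'" for z
      using eq[OF Q'(1)[OF that]] by (simp add: F_def Wpow)
    show "(\<Sum>i\<in>UNIV. (G i z)\<^sup>2) - B z \<le> (\<Sum>i\<in>UNIV. (G i z1)\<^sup>2) - B z1"
      if "z \<in> Q'" "snd z \<le> snd z1" for z
      using max[OF Q'(1,2)[OF that(1)] that(2)] by (simp add: W[symmetric] W_def)
  qed
  moreover have "2 * (\<Sum>i\<in>UNIV. G i z1 * F' i z1) = 2 * p * v powr (p - 1) * g\<^sup>2
      + q * M * g powr (q - 2) * (\<Sum>i\<in>UNIV. ugrad u z1 $ i * B' i z1)"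
  proof -
    have "(\<Sum>j\<in>UNIV. 2 * (G j z1 * H j i z1)) = B' i z1" for i
    proof -
      have "(\<Sum>j\<in>UNIV. 2 * (G j z1 * H j i z1)) - B' i z1 = 0"
      proof (rule dir_deriv_zero_at_max[OF _ \<open>open Q'\<close> z1])
        show "has_dir_deriv (\<lambda>z. W z - B z) (space_dir i)
            ((\<Sum>j\<in>UNIV. 2 * (G j z1 * H j i z1)) - B' i z1) z1"
          by (intro has_dir_deriv_diff W' B assms)
        show "W (z1 + s *\<^sub>R space_dir i) - B (z1 + s *\<^sub>R space_dir i) \<le> W z1 - B z1"
          if "z1 + s *\<^sub>R space_dir i \<in> Q'" for s
          using max[OF Q'(1,2)[OF that]] by (simp add: W space_dir_def)
      qed
      then show ?thesis by simp
    qed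
    then have "G i z1 * F' i z1 = p * v powr (p - 1) * (G i z1)\<^sup>2 
        + q * M / 2 * g powr (q - 2) * (G i z1 * B' i z1)" for i
      by (simp add: F'_def Wpow g_def U_def v_def power2_eq_square algebra_simps)
    then have "(\<Sum>i\<in>UNIV. G i z1 * F' i z1) = p * v powr (p - 1) * W z1
        + q * M / 2 * g powr (q - 2) * (\<Sum>i\<in>UNIV. G i z1 * B' i z1)"
      by (simp add: sum.distrib sum_distrib_left W_def)
    then show ?thesis by (simp add: W g_def G_def)
  qed
  moreover have "2 / real CARD('n) * (D z1 - v powr p - M * g powr q)\<^sup>2
      \<le> 2 * (\<Sum>i\<in>UNIV. \<Sum>j\<in>UNIV. (H j i z1)\<^sup>2)"
  proof -
    have "D z1 - v powr p - M * g powr q = (\<Sum>i\<in>UNIV. H i i z1)"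
      using eq[OF \<open>z1 \<in> Q\<close>] by (simp add: U_def v_def g_def)
    then show ?thesis
      using sum_diagonal_squares_le[of "\<lambda>j i. H j i z1"] by (simp add: field_simps)
  qed
  ultimately show "Bt z1 - (\<Sum>j\<in>UNIV. B'' j z1) \<le> 2 * p * v powr (p - 1) * g\<^sup>2
      + q * M * g powr (q - 2) * (\<Sum>i\<in>UNIV. ugrad u z1 $ i * B' i z1)
      - 2 / real CARD('n) * (deriv (u (fst z1)) (snd z1) - v powr p - M * g powr q)\<^sup>2"
    by (simp add: D_def)
qed

section \<open>Elementary inequalities\<close>

lemma powr_add_le:
  fixes a b \<theta> :: real
  assumes "a \<ge> 0" "b \<ge> 0" "\<theta> \<ge> 0"
  shows "(a + b) powr \<theta> \<le> 2 powr \<theta> * (a powr \<theta> + b powr \<theta>)"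
proof -
  have "(a + b) powr \<theta> \<le> (2 * max a b) powr \<theta>"
    using assms by (intro powr_mono2) auto
  also have "\<dots> = 2 powr \<theta> * max a b powr \<theta>"
    using assms by (simp add: powr_mult)
  also have "\<dots> \<le> 2 powr \<theta> * (a powr \<theta> + b powr \<theta>)"
    by (intro mult_left_mono) (auto simp: max_def)
  finally show ?thesis .
qed

text \<open>Young's inequality \<open>b * X <= c * X^2 / 2 + b^2 / (2 * c)\<close> lets half of the
  left-hand side absorb the linear term.\<close>

lemma quadratic_absorb:
  fixes a b c X :: real
  assumes "c > 0" "c * X\<^sup>2 \<le> a + b * X"
  shows "X\<^sup>2 \<le> 2 / c * (a + b\<^sup>2 / (2 * c))"
proof -
  have "2 * b * (c * X) \<le> (c * X)\<^sup>2 + b\<^sup>2"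
    using sum_squares_bound[of b "c * X"] by simp
  then have "c * (2 * (b * X)) \<le> c * (c * X\<^sup>2 + b\<^sup>2 / c)"
    using \<open>c > 0\<close> by (simp add: power2_eq_square algebra_simps)
  then have "2 * (b * X) \<le> c * X\<^sup>2 + b\<^sup>2 / c"
    using \<open>c > 0\<close> by simp
  then have "c * X\<^sup>2 \<le> 2 * a + b\<^sup>2 / c" using assms(2) by simp
  then show ?thesis using \<open>c > 0\<close> by (simp add: field_simps power2_eq_square)
qed

section \<open>Localization by a cutoff\<close>

text \<open>\<open>b = m / \<phi>\<close> for the cutoff \<open>\<phi> = \<psi> powr k * \<sigma> powr j\<close>, which vanishes on the parabolic boundary
  \<open>|x - x0| = \<rho>\<close>, \<open>t = s / 2\<close> and equals \<open>\<psi> powr k\<close> at time \<open>t = s\<close>.\<close>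

locale barrier =
  fixes x0 :: "real ^ 'n" and \<rho> s k j m :: real
begin

definition \<psi> :: "(real ^ 'n) \<times> real \<Rightarrow> real" where
  "\<psi> z = 1 - (norm (fst z - x0))\<^sup>2 / \<rho>\<^sup>2"

definition \<sigma> :: "(real ^ 'n) \<times> real \<Rightarrow> real" where
  "\<sigma> z = (2 * snd z - s) / s"

definition b :: "(real ^ 'n) \<times> real \<Rightarrow> real" where
  "b z = m * (\<psi> z powr (- k) * \<sigma> z powr (- j))"

definition b' :: "'n \<Rightarrow> (real ^ 'n) \<times> real \<Rightarrow> real" where
  "b' i z = 2 * k * m / \<rho>\<^sup>2 * \<sigma> z powr (- j) * (\<psi> z powr (- k - 1) * (fst z $ i - x0 $ i))"

definition b'' :: "'n \<Rightarrow> (real ^ 'n) \<times> real \<Rightarrow> real" where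
  "b'' i z = 2 * k * m / \<rho>\<^sup>2 * \<sigma> z powr (- j) * (\<psi> z powr (- k - 1)
      + 2 * (k + 1) / \<rho>\<^sup>2 * \<psi> z powr (- k - 2) * (fst z $ i - x0 $ i)\<^sup>2)"

definition bt :: "(real ^ 'n) \<times> real \<Rightarrow> real" where
  "bt z = - (2 * j * m / s) * (\<psi> z powr (- k) * \<sigma> z powr (- j - 1))"

lemma \<psi>_sum: "\<psi> z = 1 - (\<Sum>i\<in>UNIV. (fst z $ i - x0 $ i)\<^sup>2) / \<rho>\<^sup>2"
  by (simp add: \<psi>_def norm_vec_def L2_set_def sum_nonneg)

lemma continuous_\<psi>: "continuous_on A \<psi>" and continuous_\<sigma>: "continuous_on A \<sigma>"
  unfolding \<psi>_def[abs_def] \<sigma>_def[abs_def] divide_inverse by (intro continuous_intros)+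

lemma \<psi>_deriv: "has_dir_deriv \<psi> (space_dir i) (- 2 * (fst z $ i - x0 $ i) / \<rho>\<^sup>2) z"
proof -
  have "((\<lambda>r. (fst (z + r *\<^sub>R space_dir i) $ l - x0 $ l)\<^sup>2) has_real_derivative
      (if l = i then 2 * (fst z $ i - x0 $ i) else 0)) (at 0)" for l
    by (auto simp: space_dir_def axis_def intro!: derivative_eq_intros)
  then have "has_dir_deriv (\<lambda>z. \<Sum>l\<in>UNIV. (fst z $ l - x0 $ l)\<^sup>2) (space_dir i)
      (\<Sum>l\<in>UNIV. if l = i then 2 * (fst z $ i - x0 $ i) else 0) z"
    by (intro has_dir_deriv_sum) (simp add: has_dir_deriv_def)
  from has_dir_deriv_diff[OF has_dir_deriv_const has_dir_deriv_divide_const[OF this], of 1 "\<rho>\<^sup>2"]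
  show ?thesis by (simp add: \<psi>_sum[abs_def] minus_divide_left)
qed

lemma \<psi>_time: "has_dir_deriv \<psi> time_dir 0 z"
  by (simp add: has_dir_deriv_def \<psi>_def time_dir_def)

lemma \<sigma>_deriv: "has_dir_deriv \<sigma> (space_dir i) 0 z"
  by (simp add: has_dir_deriv_def \<sigma>_def space_dir_def)

lemma \<sigma>_time: "has_dir_deriv \<sigma> time_dir (2 / s) z"
  unfolding has_dir_deriv_def \<sigma>_def time_dir_def
  by (rule DERIV_cdivide) (auto intro!: derivative_eq_intros)

context
  fixes z assumes pos: "\<psi> z > 0" "\<sigma> z > 0"
begin

lemma b_deriv: "has_dir_deriv b (space_dir i) (b' i z) z"
  unfolding b_def[abs_def]
  by (rule has_dir_deriv_cong[OF has_dir_deriv_cmult[OF has_dir_deriv_mult[OF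
          has_dir_deriv_powr[OF \<psi>_deriv pos(1)] has_dir_deriv_powr[OF \<sigma>_deriv pos(2)]]]])
    (simp add: b'_def algebra_simps add_divide_distrib diff_divide_distrib)

lemma b'_deriv: "has_dir_deriv (b' i) (space_dir i) (b'' i z) z"
proof -
  have "has_dir_deriv (\<lambda>z. fst z $ i - x0 $ i) (space_dir i) 1 z"
    by (auto simp: has_dir_deriv_def space_dir_def axis_def intro!: derivative_eq_intros)
  note d = has_dir_deriv_mult[OF has_dir_deriv_cmult[OF has_dir_deriv_powr[OF \<sigma>_deriv pos(2)]]
      has_dir_deriv_mult[OF has_dir_deriv_powr[OF \<psi>_deriv pos(1)] this]]
  show ?thesis
    unfolding b'_def[abs_def]
    by (rule has_dir_deriv_cong[OF d])
      (simp add: b''_def power2_eq_square algebra_simps add_divide_distrib diff_divide_distrib)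
qed

lemma b_time: "has_dir_deriv b time_dir (bt z) z"
  unfolding b_def[abs_def]
  by (rule has_dir_deriv_cong[OF has_dir_deriv_cmult[OF has_dir_deriv_mult[OF
          has_dir_deriv_powr[OF \<psi>_time pos(1)] has_dir_deriv_powr[OF \<sigma>_time pos(2)]]]])
    (simp add: bt_def mult_ac)

lemma bt_eq: "bt z = - (2 * j / (s * \<sigma> z)) * b z"
  using pos by (simp add: bt_def b_def powr_diff)

lemma b'_eq: "b' i z = 2 * k / (\<rho>\<^sup>2 * \<psi> z) * b z * (fst z $ i - x0 $ i)"
  using pos by (simp add: b'_def b_def powr_diff)

text \<open>Both kinds of terms are brought to the strongest singularity: \<open>1 / \<psi>\<close>
  is at most \<open>1 / \<psi>^2\<close> because \<psi> is at most 1, and |x - x0| is at most \<rho>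
  where \<psi> is positive.\<close>

lemma laplacian_b_le:
  assumes "\<rho> > 0" "k > 0" "m \<ge> 0"
  shows "(\<Sum>i\<in>UNIV. b'' i z) \<le> (2 * k * real CARD('n) + 4 * k * (k + 1)) / (\<rho>\<^sup>2 * (\<psi> z)\<^sup>2) * b z"
proof -
  have b0: "b z \<ge> 0" using assms pos by (simp add: b_def)
  have \<psi>1: "\<psi> z \<le> 1" by (simp add: \<psi>_def)
  have sum_affine: "(\<Sum>i\<in>UNIV. a * (c + d * f i)) = a * (real CARD('n) * c + d * (\<Sum>i\<in>UNIV. f i))"
    for a c d and f :: "'n \<Rightarrow> real"
    by (simp add: sum.distrib flip: sum_distrib_left)
  have "b'' i z = 2 * k / \<rho>\<^sup>2 * b z * (1 / \<psi> z + 2 * (k + 1) / (\<rho>\<^sup>2 * (\<psi> z)\<^sup>2) * (fst z $ i - x0 $ i)\<^sup>2)" for i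
    using pos by (simp add: b''_def b_def powr_diff field_simps)
  then have "(\<Sum>i\<in>UNIV. b'' i z) = 2 * k / \<rho>\<^sup>2 * b z * (real CARD('n) * (1 / \<psi> z)
      + 2 * (k + 1) / (\<rho>\<^sup>2 * (\<psi> z)\<^sup>2) * (\<Sum>i\<in>UNIV. (fst z $ i - x0 $ i)\<^sup>2))"
    by (simp only: sum_affine)
  also have "\<dots> \<le> 2 * k / \<rho>\<^sup>2 * b z * (real CARD('n) / (\<psi> z)\<^sup>2 + 2 * (k + 1) / (\<psi> z)\<^sup>2)"
  proof (intro mult_left_mono add_mono)
    have "(\<psi> z)\<^sup>2 \<le> \<psi> z" using pos \<psi>1 by (simp add: power2_eq_square mult_left_le)
    then show "real CARD('n) * (1 / \<psi> z) \<le> real CARD('n) / (\<psi> z)\<^sup>2"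
      using pos by (simp add: divide_left_mono)
    have "(\<Sum>i\<in>UNIV. (fst z $ i - x0 $ i)\<^sup>2) \<le> \<rho>\<^sup>2"
      using pos(1) assms(1) by (simp add: \<psi>_sum field_simps)
    then have "2 * (k + 1) / (\<rho>\<^sup>2 * (\<psi> z)\<^sup>2) * (\<Sum>i\<in>UNIV. (fst z $ i - x0 $ i)\<^sup>2)
        \<le> 2 * (k + 1) / (\<rho>\<^sup>2 * (\<psi> z)\<^sup>2) * \<rho>\<^sup>2"
      using assms by (intro mult_left_mono) auto
    then show "2 * (k + 1) / (\<rho>\<^sup>2 * (\<psi> z)\<^sup>2) * (\<Sum>i\<in>UNIV. (fst z $ i - x0 $ i)\<^sup>2)
        \<le> 2 * (k + 1) / (\<psi> z)\<^sup>2"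
      using assms(1) by simp
  qed (use assms b0 in auto)
  also have "\<dots> = (2 * k * real CARD('n) + 4 * k * (k + 1)) / (\<rho>\<^sup>2 * (\<psi> z)\<^sup>2) * b z"
    using pos assms(1) by (simp add: field_simps)
  finally show ?thesis .
qed

text \<open>The spatial gradient of \<open>b\<close> is radial, and |x - x0| is at most \<rho> where
  \<psi> is positive; Cauchy--Schwarz does the rest.\<close>

lemma grad_b_le:
  assumes "\<rho> > 0" "k > 0" "m \<ge> 0"
  shows "(\<Sum>i\<in>UNIV. y $ i * b' i z) \<le> norm y * (2 * k / (\<rho> * \<psi> z) * b z)"
proof -
  have b0: "b z \<ge> 0" using assms pos by (simp add: b_def)
  have "(norm (fst z - x0))\<^sup>2 < \<rho>\<^sup>2"
    using pos(1) assms(1) by (simp add: \<psi>_def field_simps)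
  then have n: "norm (fst z - x0) \<le> \<rho>"
    using power2_less_imp_less[of "norm (fst z - x0)" \<rho>] assms(1) by simp
  have "(\<Sum>i\<in>UNIV. y $ i * b' i z) = 2 * k / (\<rho>\<^sup>2 * \<psi> z) * b z * (y \<bullet> (fst z - x0))"
    unfolding inner_vec_def sum_distrib_left by (intro sum.cong) (simp_all add: b'_eq)
  also have "\<dots> \<le> 2 * k / (\<rho>\<^sup>2 * \<psi> z) * b z * (norm y * \<rho>)"
    using assms pos b0 n
    by (intro mult_left_mono order_trans[OF norm_cauchy_schwarz]) auto
  also have "\<dots> = norm y * (2 * k / (\<rho> * \<psi> z) * b z)"
    using assms pos by (simp add: field_simps power2_eq_square)
  finally show ?thesis .
qed

end

lemma b_continuous:
  assumes "\<And>z. z \<in> A \<Longrightarrow> \<psi> z > 0 \<and> \<sigma> z > 0"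
  shows "continuous_on A b" "continuous_on A (b'' i)" "continuous_on A bt"
proof -
  have nz: "\<forall>z\<in>A. \<psi> z \<noteq> 0" "\<forall>z\<in>A. \<sigma> z \<noteq> 0" using assms by (metis less_irrefl)+
  show "continuous_on A b" "continuous_on A (b'' i)" "continuous_on A bt"
    unfolding b_def[abs_def] b''_def[abs_def] bt_def[abs_def]
    by (intro continuous_intros continuous_\<psi> continuous_\<sigma> nz)+
qed

end

section \<open>The local gradient bound under an absorption condition\<close>

text \<open>With k = 2 / (q - 1) and j = 1 / (q - 1) the summands are \<open>2 * j\<close> from the
  time derivative of the cutoff, \<open>2 * k * N + 4 * k * (k + 1)\<close> from its Laplacian and
  \<open>2 * k^2 * q^2 / c\<close> from its gradient. The factor 16/9 is the square of the ratio of
  \<open>R\<close> to the cutoff radius. The factor 162/25 is 2 * (9/5)^2, where 5/9 bounds \<psi>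
  from below on the half ball and 2 comes from \<open>powr_add_le\<close>.\<close>

definition bernstein_const :: "real \<Rightarrow> real \<Rightarrow> real \<Rightarrow> real \<Rightarrow> real" where
  "bernstein_const N q M c =
     (162 / 25 * (2 / (c * M\<^sup>2) * (2 / (q - 1)
       + 16 / 9 * (4 / (q - 1) * N + 8 / (q - 1) * (2 / (q - 1) + 1) + 8 * q\<^sup>2 / ((q - 1)\<^sup>2 * c)))))
     powr (1 / (2 * (q - 1)))"

text \<open>The equation enters beyond its viscosity form only through \<open>absorb\<close>. If the
  gradient at the maximum point of the localized function is at most \<kappa>, the first term of the
  bound results; otherwise the superlinear absorption has to be balanced by the derivatives of the
  cutoff, which gives the second.\<close>

lemma gradient_bound:
  fixes x0 :: "real ^ 'n" and u :: "real ^ 'n \<Rightarrow> real \<Rightarrow> real" and p q M c \<kappa> R T :: real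
  assumes q: "q > 1" and M: "M > 0" and c: "c > 0" and \<kappa>: "\<kappa> \<ge> 0" and R: "R > 0"
    and sol: "nonneg_classical_solution p q M (cylinder x0 R T) u"
    and absorb: "\<And>z v g. z \<in> cylinder x0 R T \<Longrightarrow> v = u (fst z) (snd z) \<Longrightarrow> g = norm (ugrad u z) \<Longrightarrow>
      v > 0 \<Longrightarrow> g > \<kappa> \<Longrightarrow>
      2 * p * v powr (p - 1) * g\<^sup>2
        - 2 / real CARD('n) * (deriv (u (fst z)) (snd z) - v powr p - M * g powr q)\<^sup>2
      \<le> - c * M\<^sup>2 * g powr (2 * q)"
    and zs: "zs \<in> cylinder x0 (R / 2) T"
  shows "norm (ugrad u zs) \<le> (9 / 5) powr (1 / (q - 1)) * \<kappa>
    + bernstein_const (real CARD('n)) q M c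
      * (R powr (- (1 / (q - 1))) + snd zs powr (- (1 / (2 * (q - 1)))))"
proof -
  define N where "N = real CARD('n)"
  \<comment> \<open>The radius lies strictly between \<open>R / 2\<close> and \<open>R\<close>: the
    closed ball stays inside the domain, while \<psi> is bounded below on the half ball. The time
    window ends at the time of \<open>zs\<close>, where \<sigma> equals 1.\<close>
  define \<rho> where "\<rho> = 3 / 4 * R"
  define s where "s = snd zs"
  txt \<open>These exponents make \<open>(\<phi> w) powr (q - 1) = \<psi>\<^sup>2 \<sigma> w powr (q - 1)\<close>, which cancels the
    singularities of the derivatives of the barrier.\<close>
  define k where "k = 2 / (q - 1)"
  define j where "j = 1 / (q - 1)"
  interpret bar: barrier x0 \<rho> s k j 1 .
  have pos: "\<rho> > 0" "s > 0" "k > 0" "j > 0" "N > 0"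
    using R q zs by (auto simp: \<rho>_def s_def k_def j_def N_def cylinder_def)
  define Q where "Q = cylinder x0 R T"
  define \<phi> where "\<phi> z = bar.\<psi> z powr k * bar.\<sigma> z powr j" for z
  define W where "W z = (norm (ugrad u z))\<^sup>2" for z
  have C21: "C21_on Q u"
    using sol by (simp add: nonneg_classical_solution_def Q_def)
  have contgrad: "continuous_on Q (ugrad u)" by (rule C21_on_derivs(5)[OF C21])

  define K where "K = cball x0 \<rho> \<times> {s / 2..s}"
  have "compact K" unfolding K_def by (intro compact_Times) auto
  have "K \<subseteq> Q"
    using zs R pos by (auto simp: K_def Q_def cylinder_def s_def \<rho>_def)
  have K_nonneg: "bar.\<psi> z \<ge> 0 \<and> bar.\<sigma> z \<ge> 0" if "z \<in> K" for z
  proof -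
    have "norm (fst z - x0) \<le> \<rho>"
      using that by (auto simp: K_def dist_norm norm_minus_commute)
    then have "(norm (fst z - x0))\<^sup>2 \<le> \<rho>\<^sup>2" by (intro power_mono) auto
    then show ?thesis
      using pos that by (auto simp: bar.\<psi>_def bar.\<sigma>_def K_def divide_simps)
  qed
  have K_le1: "bar.\<psi> z \<le> 1 \<and> bar.\<sigma> z \<le> 1" if "z \<in> K" for z
    using pos that by (auto simp: bar.\<psi>_def bar.\<sigma>_def K_def divide_simps)
  have K_pos: "z \<in> K" if "bar.\<psi> z > 0" "bar.\<sigma> z > 0" "snd z \<le> s" for z
  proof -
    have "(norm (fst z - x0))\<^sup>2 < \<rho>\<^sup>2"
      using that(1) pos by (simp add: bar.\<psi>_def field_simps)
    then have "norm (fst z - x0) < \<rho>" using pos by (intro power_less_imp_less_base[of _ 2 \<rho>]) auto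
    then show ?thesis using that pos
      by (auto simp: K_def mem_Times_iff dist_norm norm_minus_commute bar.\<sigma>_def zero_less_divide_iff)
  qed
  have zsK: "zs \<in> K" 
    using zs R pos by (auto simp: K_def cylinder_def s_def \<rho>_def)
  have \<psi>s: "bar.\<psi> zs \<ge> 5 / 9"
  proof -
    have "(norm (fst zs - x0))\<^sup>2 \<le> (R / 2)\<^sup>2"
      using zs by (intro power_mono) (auto simp: cylinder_def dist_norm norm_minus_commute)
    then show ?thesis
      using R unfolding bar.\<psi>_def by (simp add: \<rho>_def power2_eq_square field_simps)
  qed
  have \<sigma>s: "bar.\<sigma> zs = 1" using pos unfolding bar.\<sigma>_def by (simp add: s_def)
  have \<phi>_le1: "\<phi> z \<le> 1" if "z \<in> K" for z
    using K_le1[OF that] K_nonneg[OF that] pos unfolding \<phi>_def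
    by (intro mult_le_one powr_le1) auto
  have \<phi>_nonneg: "\<phi> z \<ge> 0" for z by (simp add: \<phi>_def)

  have "continuous_on K (\<lambda>z. \<phi> z * W z)"
    unfolding \<phi>_def W_def using K_nonneg pos
    by (intro continuous_intros continuous_on_powr' bar.continuous_\<psi> bar.continuous_\<sigma>
        continuous_on_subset[OF contgrad \<open>K \<subseteq> Q\<close>]) auto
  then obtain z1 where z1: "z1 \<in> K" "\<And>z. z \<in> K \<Longrightarrow> \<phi> z * W z \<le> \<phi> z1 * W z1"
    using continuous_attains_sup[OF \<open>compact K\<close>] zsK by blast
  define m where "m = \<phi> z1 * W z1"
  define g where "g = norm (ugrad u z1)"
  define gs where "gs = norm (ugrad u zs)"
  have ms: "(5 / 9) powr k * gs\<^sup>2 \<le> m"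
  proof -
    have "(5 / 9) powr k * gs\<^sup>2 \<le> \<phi> zs * W zs"
      using \<psi>s \<sigma>s pos by (simp add: \<phi>_def W_def gs_def mult_right_mono powr_mono2)
    then show ?thesis using z1(2)[OF zsK] by (simp add: m_def)
  qed
  have const_nonneg: "0 \<le> bernstein_const N q M c * (R powr (- (1 / (q - 1))) + s powr (- (1 / (2 * (q - 1)))))"
    by (simp add: bernstein_const_def)
  \<comment> \<open>Either the gradient at the maximum point is below the threshold, or the
    localized function vanishes on all of \<open>K\<close>, or the differential inequality applies
    at \<open>z1\<close>.\<close>
  consider "g \<le> \<kappa>" | "m \<le> 0" | "g > \<kappa>" "m > 0" by linarith
  then have "gs \<le> (9 / 5) powr j * \<kappa>
      + bernstein_const N q M c * (R powr (- (1 / (q - 1))) + s powr (- (1 / (2 * (q - 1)))))"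
  proof cases
    case 1
    have "m \<le> 1 * g\<^sup>2"
      unfolding m_def W_def g_def using \<phi>_le1[OF z1(1)] by (intro mult_right_mono) auto
    also have "\<dots> \<le> \<kappa>\<^sup>2" using 1 by (simp add: g_def power_mono)
    finally have "(5 / 9) powr k * gs\<^sup>2 \<le> \<kappa>\<^sup>2" using ms by simp
    then have le: "(9 / 5) powr k * ((5 / 9) powr k * gs\<^sup>2) \<le> (9 / 5) powr k * \<kappa>\<^sup>2"
      by (intro mult_left_mono) auto
    have one: "(9 / 5 :: real) powr k * (5 / 9) powr k = 1"
      using powr_mult[of "9 / 5" "5 / 9" k] by simp
    have "k = j + j" by (simp add: k_def j_def)
    then have sq: "(9 / 5 :: real) powr k = ((9 / 5) powr j)\<^sup>2"
      by (simp only: powr_add power2_eq_square)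
    have "gs\<^sup>2 \<le> ((9 / 5) powr j * \<kappa>)\<^sup>2"
      using le unfolding mult.assoc[symmetric] one unfolding sq power_mult_distrib by simp
    then have "gs \<le> (9 / 5) powr j * \<kappa>"
      using \<kappa> by (rule_tac power2_le_imp_le) auto
    then show ?thesis using const_nonneg by simp
  next
    case 2
    then have "(5 / 9) powr k * gs\<^sup>2 \<le> 0" using ms by simp
    then have "gs = 0" by (simp add: mult_le_0_iff)
    then show ?thesis using const_nonneg \<kappa> by simp
  next
    case 3
    have "\<phi> z1 > 0" "W z1 > 0"
      using \<open>m > 0\<close> \<phi>_nonneg[of z1] by (auto simp: m_def W_def zero_less_mult_iff)
    then have pos1: "bar.\<psi> z1 > 0" "bar.\<sigma> z1 > 0"
      using K_nonneg[OF z1(1)] by (auto simp: \<phi>_def zero_less_mult_iff less_le)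
    have g: "g > 0" using \<open>W z1 > 0\<close> by (simp add: W_def g_def)
    interpret B: barrier x0 \<rho> s k j m .
    define A where "A = {z. bar.\<psi> z > 0} \<inter> {z. bar.\<sigma> z > 0}"
    have "open A"
      unfolding A_def by (intro open_Int open_Collect_less bar.continuous_\<psi> bar.continuous_\<sigma> continuous_intros)
    have A: "B.\<psi> z > 0" "B.\<sigma> z > 0" if "z \<in> A" for z using that by (auto simp: A_def)
    have z1A: "z1 \<in> A" using pos1 by (simp add: A_def)
    have b_eq: "B.b z = m / \<phi> z" if "z \<in> A" for z
      using A[OF that] by (simp add: B.b_def \<phi>_def powr_minus divide_inverse)
    have b1: "B.b z1 = g\<^sup>2"
      using \<open>\<phi> z1 > 0\<close> unfolding b_eq[OF z1A] by (simp add: m_def W_def g_def)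
    define v where "v = u (fst z1) (snd z1)"
    have max: "(norm (ugrad u z))\<^sup>2 - B.b z \<le> (norm (ugrad u z1))\<^sup>2 - B.b z1"
      if "z \<in> Q" "z \<in> A" "snd z \<le> snd z1" for z
    proof -
      have "z \<in> K" using A[OF that(2)] that(3) z1(1) by (intro K_pos) (auto simp: K_def)
      then have "\<phi> z * W z \<le> m" using z1(2) by (simp add: m_def)
      moreover have "\<phi> z > 0" using A[OF that(2)] by (simp add: \<phi>_def)
      ultimately have "W z \<le> B.b z" unfolding b_eq[OF that(2)] by (simp add: field_simps)
      then show ?thesis using b1 by (simp add: W_def g_def)
    qed
    have "ugrad u z1 \<noteq> 0" using g by (simp add: g_def)
    note visc = solution_viscosity[OF sol[folded Q_def] _ \<open>open A\<close> _ z1A this B.b_deriv[OF A] B.b'_deriv[OF A]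
        B.b_time[OF A] B.b_continuous(1) B.b_continuous(2) B.b_continuous(3) max, folded v_def g_def N_def]
    have "open Q" by (simp add: Q_def open_cylinder)
    have z1Q: "z1 \<in> Q" using z1(1) \<open>K \<subseteq> Q\<close> by blast
    have "v > 0" by (rule visc(1)) (use \<open>open Q\<close> z1Q A in auto)
    have "B.bt z1 - (\<Sum>i\<in>UNIV. B.b'' i z1) \<le> 2 * p * v powr (p - 1) * g\<^sup>2
      + q * M * g powr (q - 2) * (\<Sum>i\<in>UNIV. ugrad u z1 $ i * B.b' i z1)
      - 2 / N * (deriv (u (fst z1)) (snd z1) - v powr p - M * g powr q)\<^sup>2"
      by (rule visc(2)) (use \<open>open Q\<close> z1Q A in auto)
    moreover have "2 * p * v powr (p - 1) * g\<^sup>2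
        - 2 / N * (deriv (u (fst z1)) (snd z1) - v powr p - M * g powr q)\<^sup>2
        \<le> - c * M\<^sup>2 * g powr (2 * q)"
      unfolding N_def using z1Q \<open>v > 0\<close> 3 by (intro absorb) (auto simp: v_def g_def Q_def)
    moreover have "q * M * g powr (q - 2) * (\<Sum>i\<in>UNIV. ugrad u z1 $ i * B.b' i z1)
        \<le> q * M * g powr (q - 2) * (g * (2 * k / (\<rho> * bar.\<psi> z1) * g\<^sup>2))"
      using B.grad_b_le[OF A[OF z1A], of "ugrad u z1"] pos q M \<open>m > 0\<close>
      by (intro mult_left_mono) (auto simp: b1 g_def[symmetric])
    moreover have "B.bt z1 = - (2 * j / (s * bar.\<sigma> z1)) * g\<^sup>2"
      using B.bt_eq[OF A[OF z1A]] b1 by simp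
    moreover have "(\<Sum>i\<in>UNIV. B.b'' i z1) \<le> (2 * k * N + 4 * k * (k + 1)) / (\<rho>\<^sup>2 * (bar.\<psi> z1)\<^sup>2) * g\<^sup>2"
      using B.laplacian_b_le[OF A[OF z1A]] pos \<open>m > 0\<close> by (simp add: b1 N_def)
    ultimately have main: "c * M\<^sup>2 * g powr (2 * q) \<le> (2 * j / (s * bar.\<sigma> z1)
        + (2 * k * N + 4 * k * (k + 1)) / (\<rho>\<^sup>2 * (bar.\<psi> z1)\<^sup>2)) * g\<^sup>2
        + q * M * g powr (q - 2) * (g * (2 * k / (\<rho> * bar.\<psi> z1) * g\<^sup>2))"
      by (simp add: distrib_right)
    \<comment> \<open>The absorption carries \<open>g powr (2 * q)\<close> and the gradient term of
      the barrier \<open>g powr (q + 1)\<close>. After division by \<open>g^2\<close> these are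
      \<open>X^2\<close> and \<open>X\<close>, so the inequality becomes quadratic in
      \<open>X\<close>.\<close>
    define X where "X = g powr (q - 1)"
    define \<psi>1 \<sigma>1 where "\<psi>1 = bar.\<psi> z1" and "\<sigma>1 = bar.\<sigma> z1"
    have p1: "0 < \<psi>1" "\<psi>1 \<le> 1" "0 < \<sigma>1" "\<sigma>1 \<le> 1"
      using pos1 K_le1[OF z1(1)] by (auto simp: \<psi>1_def \<sigma>1_def)
    have "g powr (2 * q) = g powr ((q - 1) + (q - 1) + 2)" by simp
    also have "\<dots> = X\<^sup>2 * g\<^sup>2"
      using g unfolding X_def powr_add by (simp add: power2_eq_square)
    finally have e1: "g powr (2 * q) = X\<^sup>2 * g\<^sup>2" .
    have "g powr (q - 1) = g powr ((q - 2) + 1)" by simp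
    then have e2: "g powr (q - 2) * g = X"
      using g unfolding X_def powr_add by simp
    have "c * M\<^sup>2 * X\<^sup>2 * g\<^sup>2 \<le> ((2 * j / (s * \<sigma>1) + (2 * k * N + 4 * k * (k + 1)) / (\<rho>\<^sup>2 * \<psi>1\<^sup>2))
        + (2 * k * q * M / (\<rho> * \<psi>1)) * X) * g\<^sup>2"
      using main unfolding e1 e2[symmetric] \<psi>1_def \<sigma>1_def by (simp add: algebra_simps)
    then have "c * M\<^sup>2 * X\<^sup>2 \<le> (2 * j / (s * \<sigma>1) + (2 * k * N + 4 * k * (k + 1)) / (\<rho>\<^sup>2 * \<psi>1\<^sup>2))
        + (2 * k * q * M / (\<rho> * \<psi>1)) * X"
      using g by (rule_tac mult_right_le_imp_le[of _ "g\<^sup>2"]) auto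
    then have X: "X\<^sup>2 \<le> 2 / (c * M\<^sup>2) * ((2 * j / (s * \<sigma>1) + (2 * k * N + 4 * k * (k + 1)) / (\<rho>\<^sup>2 * \<psi>1\<^sup>2))
        + (2 * k * q * M / (\<rho> * \<psi>1))\<^sup>2 / (2 * (c * M\<^sup>2)))"
      using c M by (intro quadratic_absorb) auto
    \<comment> \<open>The Laplacian of the barrier and the squared coefficient of \<open>X\<close>
      scale alike in \<rho> and \<open>\<psi>1\<close>; in the latter \<open>M\<close>
      cancels.\<close>
    define E where "E = 2 * k * N + 4 * k * (k + 1) + 2 * k\<^sup>2 * q\<^sup>2 / c"
    have E: "E \<ge> 0" using pos c by (simp add: E_def)
    have "(2 * k * q * M / (\<rho> * \<psi>1))\<^sup>2 / (2 * (c * M\<^sup>2)) = 2 * k\<^sup>2 * q\<^sup>2 / c / (\<rho>\<^sup>2 * \<psi>1\<^sup>2)"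
      using c M by (simp add: power_mult_distrib power_divide field_simps power2_eq_square)
    then have X: "X\<^sup>2 \<le> 2 / (c * M\<^sup>2) * (2 * j / (s * \<sigma>1) + E / (\<rho>\<^sup>2 * \<psi>1\<^sup>2))"
      using X by (simp add: E_def add_divide_distrib add.assoc)
    define \<Lambda> where "\<Lambda> = 2 / (c * M\<^sup>2) * (2 * j + 16 / 9 * E)"
    have \<Lambda>: "\<Lambda> \<ge> 0" using c pos E by (simp add: \<Lambda>_def)
    have "\<psi>1\<^sup>2 * \<sigma>1 * X\<^sup>2 \<le> \<psi>1\<^sup>2 * \<sigma>1 * (2 / (c * M\<^sup>2) * (2 * j / (s * \<sigma>1) + E / (\<rho>\<^sup>2 * \<psi>1\<^sup>2)))"
      using X p1 by (intro mult_left_mono) auto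
    also have "\<dots> = 2 / (c * M\<^sup>2) * (\<psi>1\<^sup>2 * (2 * j / s) + \<sigma>1 * (E / \<rho>\<^sup>2))"
      using p1 by (simp add: field_simps)
    also have "\<dots> \<le> 2 / (c * M\<^sup>2) * (1 * (2 * j / s) + 1 * (E / \<rho>\<^sup>2))"
      using p1 c pos E by (intro mult_left_mono add_mono mult_right_mono power_le_one) auto
    also have "\<dots> = 2 / (c * M\<^sup>2) * (2 * j * (1 / s) + 16 / 9 * E * (1 / R\<^sup>2))"
      by (simp add: \<rho>_def power_mult_distrib power_divide)
    also have "\<dots> \<le> 2 / (c * M\<^sup>2) * ((2 * j + 16 / 9 * E) * (1 / s) + (2 * j + 16 / 9 * E) * (1 / R\<^sup>2))"
      using c pos E by (intro mult_left_mono add_mono mult_right_mono) auto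
    also have "\<dots> = \<Lambda> * (1 / R\<^sup>2 + 1 / s)"
      by (simp only: \<Lambda>_def distrib_left[symmetric] mult.assoc add.commute[of "1 / s"])
    finally have XL: "\<psi>1\<^sup>2 * \<sigma>1 * X\<^sup>2 \<le> \<Lambda> * (1 / R\<^sup>2 + 1 / s)" .
    have kj: "k * (q - 1) = 2" "j * (q - 1) = 1" using q by (auto simp: k_def j_def divide_simps)
    have g2: "(g\<^sup>2) powr (q - 1) = X\<^sup>2"
      by (simp add: X_def power2_eq_square powr_mult)
    have "gs powr (2 * (q - 1)) = gs powr ((q - 1) + (q - 1))" by simp
    also have "\<dots> = (gs\<^sup>2) powr (q - 1)"
      unfolding powr_add by (simp add: power2_eq_square powr_mult)
    finally have gs2: "(gs\<^sup>2) powr (q - 1) = gs powr (2 * (q - 1))" ..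
    have "25 / 81 * gs powr (2 * (q - 1)) = ((5 / 9) powr k * gs\<^sup>2) powr (q - 1)"
      unfolding powr_mult powr_powr kj gs2 by (simp add: power2_eq_square)
    also have "\<dots> \<le> m powr (q - 1)"
      using ms q by (intro powr_mono2) auto
    also have "\<dots> = \<psi>1\<^sup>2 * \<sigma>1 * X\<^sup>2"
      using p1 by (simp add: m_def \<phi>_def W_def g_def[symmetric] \<psi>1_def[symmetric] \<sigma>1_def[symmetric]
          powr_mult powr_powr kj g2)
    finally have "gs powr (2 * (q - 1)) \<le> 81 / 25 * \<Lambda> * (1 / R\<^sup>2 + 1 / s)"
      using XL by simp
    define \<theta> where "\<theta> = 1 / (2 * (q - 1))"
    have \<theta>: "\<theta> > 0" "2 * (q - 1) * \<theta> = 1" using q by (simp_all add: \<theta>_def)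
    have "gs = (gs powr (2 * (q - 1))) powr \<theta>"
      unfolding powr_powr \<theta>(2) by (simp add: gs_def)
    also have "\<dots> \<le> (81 / 25 * \<Lambda> * (1 / R\<^sup>2 + 1 / s)) powr \<theta>"
      using \<theta> by (intro powr_mono2 \<open>gs powr _ \<le> _\<close>) auto
    also have "\<dots> = (81 / 25 * \<Lambda>) powr \<theta> * (1 / R\<^sup>2 + 1 / s) powr \<theta>"
      by (rule powr_mult)
    also have "\<dots> \<le> (81 / 25 * \<Lambda>) powr \<theta> * (2 powr \<theta> * ((1 / R\<^sup>2) powr \<theta> + (1 / s) powr \<theta>))"
      using pos \<theta> by (intro mult_left_mono powr_add_le) auto
    also have "\<dots> = (162 / 25 * \<Lambda>) powr \<theta> * ((1 / R\<^sup>2) powr \<theta> + (1 / s) powr \<theta>)"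
      using \<Lambda> powr_mult[of 2 "81 / 25 * \<Lambda>" \<theta>] by (simp add: mult_ac)
    also have "(1 / s) powr \<theta> = s powr (- (1 / (2 * (q - 1))))"
      using pos by (simp add: powr_divide powr_minus_divide \<theta>_def)
    also have "(1 / R\<^sup>2) powr \<theta> = R powr (- (1 / (q - 1)))"
    proof -
      have "(R\<^sup>2) powr \<theta> = R powr (2 * \<theta>)"
        using R by (simp add: powr_powr[symmetric])
      moreover have "2 * \<theta> = 1 / (q - 1)" using q by (auto simp: \<theta>_def divide_simps)
      ultimately show ?thesis by (simp only: powr_divide powr_minus_divide powr_one_eq_one)
    qed
    also have "(162 / 25 * \<Lambda>) powr \<theta> = bernstein_const N q M c"
      unfolding bernstein_const_def \<Lambda>_def E_def \<theta>_def j_def k_def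
      by (simp add: power_divide)
    finally show ?thesis using \<kappa> by (simp add: add_increasing)
  qed
  then show ?thesis by (simp add: gs_def N_def s_def j_def)
qed

section \<open>Absorption of the reaction term\<close>

text \<open>If \<open>v powr (p + 1)\<close> dominates \<open>g^2\<close>, the reaction term is
  absorbed by \<open>v powr (2 * p)\<close>. Otherwise \<open>v\<close> is bounded by a power of
  \<open>g\<close>, and the reaction term by a multiple of \<open>g powr (4 * p / (p + 1))\<close>.
  This exponent is below \<open>2 * q\<close> exactly because q > 2p / (p + 1), so the gradient term
  wins once \<open>g\<close> is large.\<close>

lemma reaction_absorb:
  fixes N p q M g v :: real
  assumes N: "N > 0" and p: "p > 1" and D: "(p + 1) * q - 2 * p > 0" and M: "M > 0" and g: "g > 0" and v: "v > 0"
  defines "K \<equiv> (8 * N * (p * (4 * N * p) powr ((p - 1) / (p + 1)))) powr ((p + 1) / (2 * ((p + 1) * q - 2 * p)))"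
  assumes large: "g \<ge> K * M powr (- ((p + 1) / ((p + 1) * q - 2 * p))) \<or>
      v powr (p + 1) \<ge> 4 * N * p * (K * M powr (- ((p + 1) / ((p + 1) * q - 2 * p))))\<^sup>2"
  shows "p * v powr (p - 1) * g\<^sup>2 \<le> (v powr (2 * p) / 4 + M\<^sup>2 * g powr (2 * q) / 8) / N"
proof (cases "4 * N * p * g\<^sup>2 \<le> v powr (p + 1)")
  case True
  have "4 * N * (p * v powr (p - 1) * g\<^sup>2) = v powr (p - 1) * (4 * N * p * g\<^sup>2)" by simp
  also have "\<dots> \<le> v powr (p - 1) * v powr (p + 1)" using True by (intro mult_left_mono) auto
  also have "\<dots> = v powr (2 * p)" by (simp flip: powr_add)
  finally have "p * v powr (p - 1) * g\<^sup>2 \<le> v powr (2 * p) / 4 / N" using N by (simp add: field_simps)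
  also have "\<dots> \<le> (v powr (2 * p) / 4 + M\<^sup>2 * g powr (2 * q) / 8) / N"
    using N by (intro divide_right_mono) auto
  finally show ?thesis .
next
  case False
  define d where "d = (p + 1) * q - 2 * p"
  define e where "e = (p - 1) / (p + 1)"
  define B where "B = p * (4 * N * p) powr e"
  define K0 where "K0 = K * M powr (- ((p + 1) / d))"
  have "d > 0" using D by (simp add: d_def)
  have "B > 0" using p N by (simp add: B_def)
  have K: "K = (8 * N * B) powr ((p + 1) / (2 * d))" by (simp add: K_def B_def e_def d_def)
  have "K0 \<ge> 0" by (simp add: K0_def K)
  \<comment> \<open>Here a large \<open>v\<close> forces a large \<open>g\<close>, so either
    alternative of \<open>large\<close> gives the lower bound on \<open>g\<close>.\<close>
  have "g \<ge> K0"
  proof (rule ccontr)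
    assume "\<not> g \<ge> K0"
    then have "g\<^sup>2 \<le> K0\<^sup>2" using g by (intro power_mono) auto
    then have "4 * N * p * g\<^sup>2 \<le> 4 * N * p * K0\<^sup>2" using N p by (intro mult_left_mono) auto
    then show False using large False \<open>\<not> g \<ge> K0\<close> unfolding d_def[symmetric] K0_def[symmetric] by auto
  qed
  have "v powr (p - 1) = (v powr (p + 1)) powr e"
    using p by (simp add: powr_powr e_def)
  also have "\<dots> \<le> (4 * N * p * g\<^sup>2) powr e"
    using False p by (intro powr_mono2) (auto simp: e_def)
  also have "\<dots> = (4 * N * p) powr e * g powr (2 * e)"
    using g by (simp add: powr_mult powr_powr[symmetric])
  finally have "p * v powr (p - 1) * g\<^sup>2 \<le> p * ((4 * N * p) powr e * g powr (2 * e)) * g\<^sup>2"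
    using p by (intro mult_right_mono mult_left_mono) auto
  also have "\<dots> = B * g powr (2 * e + 2)"
    using g by (simp add: B_def powr_add)
  finally have le: "p * v powr (p - 1) * g\<^sup>2 \<le> B * g powr (2 * e + 2)" .
  \<comment> \<open>This identity determines \<open>K\<close>: at \<open>g = K0\<close> the bound
    \<open>B * g powr (2 * e + 2)\<close> equals the available
    \<open>M^2 * g powr (2 * q) / (8 * N)\<close>.\<close>
  have "8 * N * B = M\<^sup>2 * K0 powr (2 * d / (p + 1))"
  proof -
    have "(p + 1) / (2 * d) * (2 * d / (p + 1)) = 1" "- ((p + 1) / d) * (2 * d / (p + 1)) = - 2"
      using \<open>d > 0\<close> p by (simp_all add: divide_simps)
    then have "K0 powr (2 * d / (p + 1)) = (8 * N * B) powr 1 * M powr (- 2)"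
      by (simp only: K0_def K powr_mult powr_powr)
    then show ?thesis using M N \<open>B > 0\<close> by (simp add: powr_minus)
  qed
  also have "\<dots> \<le> M\<^sup>2 * g powr (2 * d / (p + 1))"
    using \<open>g \<ge> K0\<close> \<open>K0 \<ge> 0\<close> \<open>d > 0\<close> p by (intro mult_left_mono powr_mono2) auto
  finally have "8 * N * B * g powr (2 * e + 2) \<le> M\<^sup>2 * g powr (2 * d / (p + 1)) * g powr (2 * e + 2)"
    by (intro mult_right_mono) auto
  also have "\<dots> = M\<^sup>2 * g powr (2 * d / (p + 1) + (2 * e + 2))"
    by (simp add: powr_add)
  also have "2 * d / (p + 1) + (2 * e + 2) = 2 * q"
  proof -
    have "2 * d / (p + 1) = 2 * q - 4 * p / (p + 1)" using p by (simp add: d_def field_simps)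
    moreover have "2 * e + 2 = 4 * p / (p + 1)" using p by (simp add: e_def field_simps)
    ultimately show ?thesis by simp
  qed
  finally have "B * g powr (2 * e + 2) \<le> M\<^sup>2 * g powr (2 * q) / 8 / N"
    using N by (simp add: field_simps)
  also have "\<dots> \<le> (v powr (2 * p) / 4 + M\<^sup>2 * g powr (2 * q) / 8) / N"
    using N by (intro divide_right_mono) auto
  finally show ?thesis using le by simp
qed

text \<open>With \<open>a\<close> and \<open>b\<close> for the two nonlinear terms, \<open>w\<close>
  is at most \<open>(a + b) / 2\<close>, so the negative square contributes at least
  \<open>(a^2 + b^2) / (2 * N)\<close>. The reaction term uses up the whole share of
  \<open>a\<close> and half of that of \<open>b\<close>; the other half,
  \<open>b^2 / (4 * N)\<close>, is left.\<close>

lemma bernstein_coercive: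
  fixes N p q M g v w \<tau> :: real
  assumes N: "N > 0" and w: "w \<le> \<tau>" and \<tau>: "2 * \<tau> \<le> v powr p + M * g powr q" and M: "M > 0"
    and g: "g > 0" and v: "v > 0"
    and absorb: "p * v powr (p - 1) * g\<^sup>2 \<le> (v powr (2 * p) / 4 + M\<^sup>2 * g powr (2 * q) / 8) / N"
  shows "2 * p * v powr (p - 1) * g\<^sup>2 - 2 / N * (w - v powr p - M * g powr q)\<^sup>2
      \<le> - (1 / (4 * N)) * M\<^sup>2 * g powr (2 * q)"
proof -
  have sq: "v powr (2 * p) = (v powr p)\<^sup>2" "g powr (2 * q) = (g powr q)\<^sup>2"
    using v g by (simp_all add: power2_eq_square flip: powr_add)
  define a b where "a = v powr p" and "b = M * g powr q"
  have ab: "a \<ge> 0" "b \<ge> 0" using M by (simp_all add: a_def b_def)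
  have "((a + b) / 2)\<^sup>2 \<le> (a + b - w)\<^sup>2"
    using ab w \<tau> by (intro power_mono) (auto simp: a_def b_def)
  moreover have "a\<^sup>2 + b\<^sup>2 \<le> (a + b)\<^sup>2" using ab by (simp add: power2_sum)
  ultimately have "a\<^sup>2 + b\<^sup>2 \<le> 4 * (w - a - b)\<^sup>2"
    by (simp add: power2_eq_square field_simps)
  then have "2 * ((a\<^sup>2 + b\<^sup>2) / 4) / N \<le> 2 * (w - a - b)\<^sup>2 / N"
    using N by (intro divide_right_mono) auto
  then have "2 * (p * v powr (p - 1) * g\<^sup>2) - 2 / N * (w - a - b)\<^sup>2
      \<le> 2 * ((a\<^sup>2 / 4 + b\<^sup>2 / 8) / N) - 2 * ((a\<^sup>2 + b\<^sup>2) / 4) / N"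
  proof -
    have "p * v powr (p - 1) * g\<^sup>2 \<le> (a\<^sup>2 / 4 + b\<^sup>2 / 8) / N"
      using absorb by (simp add: sq a_def b_def power_mult_distrib)
    moreover have "2 / N * (w - a - b)\<^sup>2 = 2 * (w - a - b)\<^sup>2 / N" by simp
    ultimately show ?thesis using \<open>2 * ((a\<^sup>2 + b\<^sup>2) / 4) / N \<le> _\<close> by linarith
  qed
  also have "\<dots> = - (1 / (4 * N)) * b\<^sup>2"
    using N by (simp add: field_simps)
  finally show ?thesis
    unfolding sq(2) by (simp add: a_def b_def power_mult_distrib mult_ac)
qed

section \<open>The gradient estimates for the equation\<close>

text \<open>The hypothesis \<open>large\<close> is a pointwise condition that covers both cases of
  the theorem: it can be ensured by a threshold \<kappa> on the gradient, or by a lower bound on the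
  solution with \<kappa> = 0.\<close>

lemma gradient_estimate:
  fixes p q M R T \<tau> :: real and x0 :: "real ^ 'n" and u :: "real ^ 'n \<Rightarrow> real \<Rightarrow> real"
  defines "N \<equiv> real CARD('n)"
  defines "K \<equiv> (8 * N * (p * (4 * N * p) powr ((p - 1) / (p + 1)))) powr ((p + 1) / (2 * ((p + 1) * q - 2 * p)))"
  assumes p: "p > 1" and q: "q > 2 * p / (p + 1)" and M: "M > 0" and R: "R > 0" and \<kappa>: "\<kappa> \<ge> 0"
    and sol: "nonneg_classical_solution p q M (cylinder x0 R T) u"
    and ut: "\<forall>(x, t)\<in>cylinder x0 R T. deriv (u x) t \<le> \<tau>"
    and large: "\<And>x t v g. (x, t) \<in> cylinder x0 R T \<Longrightarrow> v = u x t \<Longrightarrow> v > 0 \<Longrightarrow> g > \<kappa> \<Longrightarrow>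
      2 * \<tau> \<le> v powr p + M * g powr q \<and>
      (g \<ge> K * M powr (- ((p + 1) / ((p + 1) * q - 2 * p))) \<or>
        v powr (p + 1) \<ge> 4 * N * p * (K * M powr (- ((p + 1) / ((p + 1) * q - 2 * p))))\<^sup>2)"
    and xt: "(x, t) \<in> cylinder x0 (R / 2) T"
  shows "norm (gradient (\<lambda>y. u y t) x) \<le> (9 / 5) powr (1 / (q - 1)) * \<kappa>
    + bernstein_const N q M (1 / (4 * N)) * (R powr (- (1 / (q - 1))) + t powr (- (1 / (2 * (q - 1)))))"
proof -
  have N: "N > 0" by (simp add: N_def)
  have d: "(p + 1) * q - 2 * p > 0" using p q by (simp add: field_simps)
  have "2 * p / (p + 1) > 1" using p by simp
  then have q1: "q > 1" using q by simp
  have "norm (ugrad u (x, t)) \<le> (9 / 5) powr (1 / (q - 1)) * \<kappa>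
    + bernstein_const (real CARD('n)) q M (1 / (4 * N))
      * (R powr (- (1 / (q - 1))) + snd (x, t) powr (- (1 / (2 * (q - 1)))))"
  proof (rule gradient_bound[OF q1 M _ \<kappa> R sol _ xt])
    show "1 / (4 * N) > 0" using N by simp
    fix z v g
    assume z: "z \<in> cylinder x0 R T" and v: "v = u (fst z) (snd z)" "v > 0" and g: "g > \<kappa>"
    have g0: "g > 0" using g \<kappa> by simp
    have l: "2 * \<tau> \<le> v powr p + M * g powr q"
      "g \<ge> K * M powr (- ((p + 1) / ((p + 1) * q - 2 * p))) \<or>
        v powr (p + 1) \<ge> 4 * N * p * (K * M powr (- ((p + 1) / ((p + 1) * q - 2 * p))))\<^sup>2"
      using large[of "fst z" "snd z" v g] z v g by auto
    have "deriv (u (fst z)) (snd z) \<le> \<tau>" using bspec[OF ut z] by (simp add: case_prod_unfold)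
    then show "2 * p * v powr (p - 1) * g\<^sup>2
        - 2 / real CARD('n) * (deriv (u (fst z)) (snd z) - v powr p - M * g powr q)\<^sup>2
      \<le> - (1 / (4 * N)) * M\<^sup>2 * g powr (2 * q)"
      unfolding N_def[symmetric]
      by (rule bernstein_coercive[OF N _ l(1) M g0 v(2) reaction_absorb[OF N p d M g0 v(2) l(2)[unfolded K_def]]])
  qed
  then show ?thesis by (simp add: ugrad_def N_def)
qed

theorem theorem1p5:
  fixes p q :: real
  assumes "p > 1" and "q > 2 * p / (p + 1)"
  shows
    "(\<exists>C1>0. \<forall>M>0. \<exists>C2>0.
        \<forall>(x0 :: real ^ 'n) R T \<tau> u.
          R > 0 \<longrightarrow> T > 0 \<longrightarrow> \<tau> \<ge> 0 \<longrightarrow>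
          nonneg_classical_solution p q M (cylinder x0 R T) u \<longrightarrow>
          (\<forall>(x, t)\<in>cylinder x0 R T. deriv (u x) t \<le> \<tau>) \<longrightarrow>
          (\<forall>(x, t)\<in>cylinder x0 (R / 2) T.
             norm (gradient (\<lambda>y. u y t) x) \<le>
               C1 * (M powr (- ((p + 1) / ((p + 1) * q - 2 * p)))
                     + M powr (- (1 / q)) * \<tau> powr (1 / q))
               + C2 * (R powr (- (1 / (q - 1))) + t powr (- (1 / (2 * (q - 1)))))))
     \<and>
     (\<exists>c>0. \<forall>M>0. \<exists>C>0.
        \<forall>(x0 :: real ^ 'n) R T \<tau> u.
          R > 0 \<longrightarrow> T > 0 \<longrightarrow> \<tau> \<ge> 0 \<longrightarrow>
          nonneg_classical_solution p q M (cylinder x0 R T) u \<longrightarrow>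
          (\<forall>(x, t)\<in>cylinder x0 R T. deriv (u x) t \<le> \<tau>) \<longrightarrow>
          (\<forall>(x, t)\<in>cylinder x0 R T.
             u x t \<ge> c * (M powr (- (2 / ((p + 1) * q - 2 * p))) + \<tau> powr (1 / p))) \<longrightarrow>
          (\<forall>(x, t)\<in>cylinder x0 (R / 2) T.
             norm (gradient (\<lambda>y. u y t) x) \<le>
               C * (R powr (- (1 / (q - 1))) + t powr (- (1 / (2 * (q - 1)))))))"
proof -
  define N where "N = real CARD('n)"
  define d where "d = (p + 1) * q - 2 * p"
  define K where "K = (8 * N * (p * (4 * N * p) powr ((p - 1) / (p + 1)))) powr ((p + 1) / (2 * d))"
  \<comment> \<open>The summand 1 makes the constant strictly positive.\<close>
  define C where "C M = bernstein_const N q M (1 / (4 * N)) + 1" for M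
  have p: "p > 1" by fact
  have N: "N > 0" by (simp add: N_def)
  have d: "d > 0" using p assms(2) by (simp add: d_def field_simps)
  have "2 * p / (p + 1) > 1" using p by simp
  then have q: "q > 1" using assms(2) by simp
  have K: "K \<ge> 0" by (simp add: K_def)
  have C: "C M > 0" for M by (simp add: C_def bernstein_const_def add_nonneg_pos)
  note est = gradient_estimate[OF assms, where 'n = 'n, folded N_def, folded d_def, folded K_def]
  have C_le: "bernstein_const N q M (1 / (4 * N)) * (a + b) \<le> C M * (a + b)"
    if "a \<ge> 0" "b \<ge> 0" for M a b :: real
    using that by (intro mult_right_mono) (auto simp: C_def)

  \<comment> \<open>For \<open>g\<close> above the threshold, \<open>K\<close> secures the
    absorption of the reaction term and \<open>2 powr (1 / q)\<close> secures that
    \<open>M * g powr q\<close> is at least \<open>2 * \<tau>\<close>.\<close>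
  define K1 where "K1 = max K (2 powr (1 / q))"
  have K1: "K1 > 0" "K1 \<ge> K" "K1 powr q \<ge> 2"
  proof -
    have "K1 \<ge> 2 powr (1 / q)" by (simp add: K1_def)
    moreover have "(2 :: real) powr (1 / q) > 0" by simp
    ultimately show "K1 > 0" by linarith
    have "(2 powr (1 / q)) powr q \<le> K1 powr q"
      using \<open>K1 \<ge> 2 powr (1 / q)\<close> q by (intro powr_mono2) auto
    then show "K1 powr q \<ge> 2" using q by (simp add: powr_powr)
  qed (simp add: K1_def)
  define C1 where "C1 = (9 / 5) powr (1 / (q - 1)) * K1"
  have part1: "norm (gradient (\<lambda>y. u y t) x) \<le>
      C1 * (M powr (- ((p + 1) / d)) + M powr (- (1 / q)) * \<tau> powr (1 / q))
      + C M * (R powr (- (1 / (q - 1))) + t powr (- (1 / (2 * (q - 1)))))"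
    if "M > 0" "R > 0" "\<tau> \<ge> 0" "nonneg_classical_solution p q M (cylinder x0 R T) u"
      "\<forall>(x, t)\<in>cylinder x0 R T. deriv (u x) t \<le> \<tau>" "(x, t) \<in> cylinder x0 (R / 2) T"
    for M R T \<tau> x t u and x0 :: "real ^ 'n"
  proof -
    define \<kappa> where "\<kappa> = K1 * (M powr (- ((p + 1) / d)) + M powr (- (1 / q)) * \<tau> powr (1 / q))"
    have "\<kappa> \<ge> 0" using K1 by (simp add: \<kappa>_def)
    have "norm (gradient (\<lambda>y. u y t) x) \<le> (9 / 5) powr (1 / (q - 1)) * \<kappa>
      + bernstein_const N q M (1 / (4 * N)) * (R powr (- (1 / (q - 1))) + t powr (- (1 / (2 * (q - 1)))))"
    proof (rule est[OF that(1,2) \<open>\<kappa> \<ge> 0\<close> that(4,5) _ that(6)])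
      fix v g :: real
      assume "v > 0" "g > \<kappa>"
      have "K * M powr (- ((p + 1) / d)) \<le> K1 * (M powr (- ((p + 1) / d)) + M powr (- (1 / q)) * \<tau> powr (1 / q))"
        using K K1 by (intro mult_mono) auto
      then have "g \<ge> K * M powr (- ((p + 1) / d))" using \<open>g > \<kappa>\<close> by (simp add: \<kappa>_def)
      moreover have "2 * \<tau> \<le> M * g powr q"
      proof -
        have "2 * \<tau> \<le> K1 powr q * \<tau>" using K1 that(3) by (intro mult_right_mono) auto
        also have "\<dots> = M * (K1 * (M powr (- (1 / q)) * \<tau> powr (1 / q))) powr q"
        proof -
          have "- (1 / q) * q = - 1" "1 / q * q = 1" using q by simp_all
          then show ?thesis
            unfolding powr_mult powr_powr using that(1,3) by (simp add: powr_minus)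
        qed
        also have "\<dots> \<le> M * g powr q"
        proof (intro mult_left_mono powr_mono2)
          have "K1 * (M powr (- (1 / q)) * \<tau> powr (1 / q)) \<le> \<kappa>"
            unfolding \<kappa>_def using K1 by (intro mult_left_mono) auto
          then show "K1 * (M powr (- (1 / q)) * \<tau> powr (1 / q)) \<le> g" using \<open>g > \<kappa>\<close> by simp
        qed (use K1 q that(1) in auto)
        finally show ?thesis .
      qed
      ultimately show "2 * \<tau> \<le> v powr p + M * g powr q \<and>
          (K * M powr (- ((p + 1) / d)) \<le> g \<or> 4 * N * p * (K * M powr (- ((p + 1) / d)))\<^sup>2 \<le> v powr (p + 1))"
        by (simp add: add_increasing)
    qed
    also have "(9 / 5) powr (1 / (q - 1)) * \<kappa>
        = C1 * (M powr (- ((p + 1) / d)) + M powr (- (1 / q)) * \<tau> powr (1 / q))"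
      by (simp add: C1_def \<kappa>_def)
    finally show ?thesis
      using C_le[of "R powr (- (1 / (q - 1)))" "t powr (- (1 / (2 * (q - 1))))" M] by simp
  qed

  \<comment> \<open>The first entry gives \<open>v powr p >= 2 * \<tau>\<close>. The second gives
    the alternative of \<open>large\<close> on \<open>v\<close>, since raising
    \<open>M powr (- (2 / d))\<close> to the power \<open>p + 1\<close> yields the square of
    \<open>M powr (- ((p + 1) / d))\<close>.\<close>
  define c where "c = max (2 powr (1 / p)) ((4 * N * p * K\<^sup>2) powr (1 / (p + 1)))"
  have c: "c > 0" "c powr p \<ge> 2" "c powr (p + 1) \<ge> 4 * N * p * K\<^sup>2"
  proof -
    have "c \<ge> 2 powr (1 / p)" by (simp add: c_def)
    moreover have "(2 :: real) powr (1 / p) > 0" by simp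
    ultimately show "c > 0" by linarith
    have "(2 powr (1 / p)) powr p \<le> c powr p"
      using \<open>c \<ge> 2 powr (1 / p)\<close> p by (intro powr_mono2) auto
    then show "c powr p \<ge> 2" using p by (simp add: powr_powr)
    have "((4 * N * p * K\<^sup>2) powr (1 / (p + 1))) powr (p + 1) \<le> c powr (p + 1)"
      using p by (intro powr_mono2) (auto simp: c_def)
    then show "c powr (p + 1) \<ge> 4 * N * p * K\<^sup>2" using p N by (simp add: powr_powr)
  qed
  have part2: "norm (gradient (\<lambda>y. u y t) x) \<le>
      C M * (R powr (- (1 / (q - 1))) + t powr (- (1 / (2 * (q - 1)))))"
    if "M > 0" "R > 0" "\<tau> \<ge> 0" "nonneg_classical_solution p q M (cylinder x0 R T) u"
      "\<forall>(x, t)\<in>cylinder x0 R T. deriv (u x) t \<le> \<tau>" "(x, t) \<in> cylinder x0 (R / 2) T"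
      and low: "\<forall>(x, t)\<in>cylinder x0 R T. u x t \<ge> c * (M powr (- (2 / d)) + \<tau> powr (1 / p))"
    for M R T \<tau> x t u and x0 :: "real ^ 'n"
  proof -
    \<comment> \<open>The lower bound on \<open>u\<close> ensures the absorption for gradients of
      every positive size, so the threshold is 0 and the first term disappears.\<close>
    have "norm (gradient (\<lambda>y. u y t) x) \<le> (9 / 5) powr (1 / (q - 1)) * 0
      + bernstein_const N q M (1 / (4 * N)) * (R powr (- (1 / (q - 1))) + t powr (- (1 / (2 * (q - 1)))))"
    proof (rule est[OF that(1,2) order_refl that(4,5) _ that(6)])
      fix y s v g
      assume ys: "(y, s) \<in> cylinder x0 R T" "v = u y s" and v: "v > 0" and g: "g > (0 :: real)"
      have low: "v \<ge> c * M powr (- (2 / d))" "v \<ge> c * \<tau> powr (1 / p)"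
      proof -
        have "v \<ge> c * M powr (- (2 / d)) + c * \<tau> powr (1 / p)"
          using low ys by (auto simp: distrib_left)
        moreover have "c * M powr (- (2 / d)) \<ge> 0" "c * \<tau> powr (1 / p) \<ge> 0"
          using c(1) by auto
        ultimately show "v \<ge> c * M powr (- (2 / d))" "v \<ge> c * \<tau> powr (1 / p)" by linarith+
      qed
      have "2 * \<tau> \<le> c powr p * \<tau>" using c that(3) by (intro mult_right_mono) auto
      also have "\<dots> = (c * \<tau> powr (1 / p)) powr p"
        using p that(3) by (simp add: powr_mult powr_powr)
      also have "\<dots> \<le> v powr p" using low(2) c(1) p by (intro powr_mono2) auto
      finally have "2 * \<tau> \<le> v powr p" .
      moreover have "4 * N * p * (K * M powr (- ((p + 1) / d)))\<^sup>2 \<le> v powr (p + 1)"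
      proof -
        have "(M powr (- ((p + 1) / d)))\<^sup>2 = M powr (- ((p + 1) / d) + - ((p + 1) / d))"
          by (simp only: power2_eq_square powr_add)
        also have "- ((p + 1) / d) + - ((p + 1) / d) = - (2 / d) * (p + 1)"
          using d by (simp add: field_simps)
        finally have M2: "(M powr (- ((p + 1) / d)))\<^sup>2 = (M powr (- (2 / d))) powr (p + 1)"
          by (simp only: powr_powr)
        have "4 * N * p * (K * M powr (- ((p + 1) / d)))\<^sup>2 = 4 * N * p * K\<^sup>2 * (M powr (- (2 / d))) powr (p + 1)"
          unfolding power_mult_distrib M2 by simp
        also have "\<dots> \<le> c powr (p + 1) * (M powr (- (2 / d))) powr (p + 1)"
          using c(3) by (intro mult_right_mono) auto
        also have "\<dots> = (c * M powr (- (2 / d))) powr (p + 1)" by (rule powr_mult[symmetric])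
        also have "\<dots> \<le> v powr (p + 1)" using low(1) c(1) p by (intro powr_mono2) auto
        finally show ?thesis .
      qed
      ultimately show "2 * \<tau> \<le> v powr p + M * g powr q \<and>
          (K * M powr (- ((p + 1) / d)) \<le> g \<or> 4 * N * p * (K * M powr (- ((p + 1) / d)))\<^sup>2 \<le> v powr (p + 1))"
        using that(1) by (simp add: add_increasing2)
    qed
    then show ?thesis
      using C_le[of "R powr (- (1 / (q - 1)))" "t powr (- (1 / (2 * (q - 1))))" M] by simp
  qed

  have "C1 > 0" using K1 by (simp add: C1_def)
  show ?thesis
    unfolding d_def[symmetric]
  proof (intro conjI)
    show "\<exists>C1>0. \<forall>M>0. \<exists>C2>0. \<forall>(x0 :: real ^ 'n) R T \<tau> u.
          R > 0 \<longrightarrow> T > 0 \<longrightarrow> \<tau> \<ge> 0 \<longrightarrow>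
          nonneg_classical_solution p q M (cylinder x0 R T) u \<longrightarrow>
          (\<forall>(x, t)\<in>cylinder x0 R T. deriv (u x) t \<le> \<tau>) \<longrightarrow>
          (\<forall>(x, t)\<in>cylinder x0 (R / 2) T.
             norm (gradient (\<lambda>y. u y t) x) \<le>
               C1 * (M powr (- ((p + 1) / d)) + M powr (- (1 / q)) * \<tau> powr (1 / q))
               + C2 * (R powr (- (1 / (q - 1))) + t powr (- (1 / (2 * (q - 1))))))"
    proof (rule exI[of _ C1], intro conjI allI impI \<open>C1 > 0\<close>, goal_cases)
      case (1 M)
      then show ?case
        using part1 C by (intro exI[of _ "C M"]) blast
    qed
    show "\<exists>c>0. \<forall>M>0. \<exists>C>0. \<forall>(x0 :: real ^ 'n) R T \<tau> u.
          R > 0 \<longrightarrow> T > 0 \<longrightarrow> \<tau> \<ge> 0 \<longrightarrow>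
          nonneg_classical_solution p q M (cylinder x0 R T) u \<longrightarrow>
          (\<forall>(x, t)\<in>cylinder x0 R T. deriv (u x) t \<le> \<tau>) \<longrightarrow>
          (\<forall>(x, t)\<in>cylinder x0 R T. u x t \<ge> c * (M powr (- (2 / d)) + \<tau> powr (1 / p))) \<longrightarrow>
          (\<forall>(x, t)\<in>cylinder x0 (R / 2) T.
             norm (gradient (\<lambda>y. u y t) x) \<le>
               C * (R powr (- (1 / (q - 1))) + t powr (- (1 / (2 * (q - 1))))))"
    proof (rule exI[of _ c], intro conjI allI impI c(1), goal_cases)
      case (1 M)
      then show ?case
        using part2 C by (intro exI[of _ "C M"]) blast
    qed
  qed
qed

end
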